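(* Let $N$ be the once-punctured hyperbolic torus bundle with $$\pi_1(N)=\left\langle\alpha,\beta,\tau\;\middle|\;\tau\alpha\tau^{-1}=(\beta\alpha\beta)^{-1},\ \tau\beta\tau^{-1}=\beta\alpha(\beta\alpha\beta)^{-3}\right\rangle,$$ let $\lambda=[\alpha,\beta]$, and let $\mathsf{X}_0,\mathsf{X}_1$ be the two hyperbolic curves in $\mathsf{X}(N)$. Put $l=I_\lambda$, $y=I_\beta$, $z=I_{\alpha\beta}$. For each $\epsilon\in\{0,1\}$ the set $$\mathcal{B}_{\mathbb{C}}=\{1,z,z^2,z^3,y,zy,z^2y,z^3y\}$$ is a basis for $\mathbb{C}[\mathsf{X}_\epsilon]$ as a $\mathbb{C}[l]$-module.
   Context: $\mathsf{X}(N)$ is the affine algebraic set of characters $\chi_\rho=\mathrm{Tr}\circ\rho$ of representations $\rho\colon\pi_1(N)\to\mathrm{SL}_2(\mathbb{C})$. A hyperbolic curve is an irreducible algebraic component of $\mathsf{X}(N)$ containing the character of a discrete faithful representation; for this $N$ there are exactly two, labelled $\mathsf{X}_0$ and $\mathsf{X}_1$. For $\gamma\in\pi_1(N)$, $I_\gamma\in\mathbb{C}[\mathsf{X}_\epsilon]$ is the regular function $I_\gamma(\chi)=\chi(\gamma)$. *)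

theory Defs
  imports "HOL-Analysis.Analysis" "HOL-Algebra.Group"
begin

section \<open>Groups given by generators and relations\<close>

text \<open>A letter \<open>(g, False)\<close> stands for the generator \<open>g\<close>, and \<open>(g, True)\<close> for its inverse.
  A relation \<open>u = v\<close> is given as the pair \<open>(u, v)\<close> of words.\<close>

type_synonym 'g word = "('g \<times> bool) list"

definition word_inv :: "'g word \<Rightarrow> 'g word" where
  "word_inv w = rev (map (\<lambda>(g, e). (g, \<not> e)) w)"

inductive word_eq :: "('g word \<times> 'g word) set \<Rightarrow> 'g word \<Rightarrow> 'g word \<Rightarrow> bool"
  for R :: "('g word \<times> 'g word) set" where
  word_eq_rel: "(u, v) \<in> R \<Longrightarrow> word_eq R u v"
| word_eq_cancel: "word_eq R [(g, e), (g, \<not> e)] []"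
| word_eq_refl: "word_eq R u u"
| word_eq_sym: "word_eq R u v \<Longrightarrow> word_eq R v u"
| word_eq_trans: "word_eq R u v \<Longrightarrow> word_eq R v w \<Longrightarrow> word_eq R u w"
| word_eq_append: "word_eq R u u' \<Longrightarrow> word_eq R v v' \<Longrightarrow> word_eq R (u @ v) (u' @ v')"

definition word_class :: "('g word \<times> 'g word) set \<Rightarrow> 'g word \<Rightarrow> 'g word set" where
  "word_class R w = {v. word_eq R w v}"

definition presented_group :: "('g word \<times> 'g word) set \<Rightarrow> 'g word set monoid" where
  "presented_group R =
     \<lparr> carrier = range (word_class R),
       mult = (\<lambda>X Y. \<Union>u\<in>X. \<Union>v\<in>Y. word_class R (u @ v)),
       one = word_class R [] \<rparr>"

lemma word_class_eq_iff: "word_class R u = word_class R v \<longleftrightarrow> word_eq R u v"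
proof
  assume "word_class R u = word_class R v"
  moreover have "v \<in> word_class R v" by (simp add: word_class_def word_eq_refl)
  ultimately show "word_eq R u v" unfolding word_class_def by blast
next
  assume uv: "word_eq R u v"
  have "word_eq R u w \<longleftrightarrow> word_eq R v w" for w
    using uv word_eq_trans word_eq_sym by metis
  then show "word_class R u = word_class R v" by (simp add: word_class_def)
qed

lemma presented_group_mult:
  "word_class R u \<otimes>\<^bsub>presented_group R\<^esub> word_class R v = word_class R (u @ v)"
proof -
  have "word_class R (u' @ v') = word_class R (u @ v)"
    if "u' \<in> word_class R u" "v' \<in> word_class R v" for u' v'
    unfolding word_class_eq_iff using that unfolding word_class_def mem_Collect_eq
    by (intro word_eq_append) (rule word_eq_sym, assumption)+
  moreover have "u \<in> word_class R u" "v \<in> word_class R v"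
    by (simp_all add: word_class_def word_eq_refl)
  ultimately have "(\<Union>u'\<in>word_class R u. \<Union>v'\<in>word_class R v. word_class R (u' @ v')) =
      word_class R (u @ v)" by blast
  then show ?thesis
    by (simp add: presented_group_def)
qed

lemma word_eq_inv: "word_eq R (word_inv w @ w) []"
proof (induction w)
  case Nil
  show ?case by (simp add: word_inv_def word_eq_refl)
next
  case (Cons a w)
  obtain g e where a: "a = (g, e)" by force
  have "word_eq R [(g, \<not> e), (g, \<not> \<not> e)] []" by (rule word_eq_cancel)
  then have "word_eq R (word_inv w @ ([(g, \<not> e), (g, e)] @ w)) (word_inv w @ ([] @ w))"
    by (intro word_eq_append word_eq_refl) simp
  then have "word_eq R (word_inv (a # w) @ a # w) (word_inv w @ w)"
    by (simp add: word_inv_def a)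
  then show ?case using Cons word_eq_trans by blast
qed

lemma group_presented_group: "group (presented_group R)"
proof (rule groupI)
  show "\<one>\<^bsub>presented_group R\<^esub> \<in> carrier (presented_group R)"
    by (auto simp: presented_group_def)
next
  fix x assume "x \<in> carrier (presented_group R)"
  then obtain u where u: "x = word_class R u"
    by (auto simp: presented_group_def)
  have one: "\<one>\<^bsub>presented_group R\<^esub> = word_class R []"
    by (simp add: presented_group_def)
  show "\<one>\<^bsub>presented_group R\<^esub> \<otimes>\<^bsub>presented_group R\<^esub> x = x"
    by (simp add: u one presented_group_mult)
  have "word_class R (word_inv u) \<in> carrier (presented_group R)"
    by (simp add: presented_group_def)
  moreover have "word_class R (word_inv u) \<otimes>\<^bsub>presented_group R\<^esub> x = \<one>\<^bsub>presented_group R\<^esub>"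
    by (simp add: u one presented_group_mult word_class_eq_iff word_eq_inv)
  ultimately show "\<exists>y\<in>carrier (presented_group R).
      y \<otimes>\<^bsub>presented_group R\<^esub> x = \<one>\<^bsub>presented_group R\<^esub>" by blast
next
  fix x y assume "x \<in> carrier (presented_group R)" "y \<in> carrier (presented_group R)"
  then obtain u v where "x = word_class R u" "y = word_class R v"
    by (auto simp: presented_group_def)
  then show "x \<otimes>\<^bsub>presented_group R\<^esub> y \<in> carrier (presented_group R)"
    by (simp add: presented_group_mult) (simp add: presented_group_def)
next
  fix x y z
  assume "x \<in> carrier (presented_group R)" "y \<in> carrier (presented_group R)"
    "z \<in> carrier (presented_group R)"
  then obtain u v w where "x = word_class R u" "y = word_class R v" "z = word_class R w"
    by (auto simp: presented_group_def)
  then show "x \<otimes>\<^bsub>presented_group R\<^esub> y \<otimes>\<^bsub>presented_group R\<^esub> z =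
      x \<otimes>\<^bsub>presented_group R\<^esub> (y \<otimes>\<^bsub>presented_group R\<^esub> z)"
    by (simp add: presented_group_mult)
qed


section \<open>Characters of representations into \<open>SL\<^sub>2(\<complex>)\<close>\<close>

definition SL2 :: "(complex^2^2) monoid" where
  "SL2 = \<lparr> carrier = {A. det A = 1}, mult = (**), one = mat 1 \<rparr>"

lemma group_SL2: "group SL2"
proof (rule groupI)
  fix A assume "A \<in> carrier SL2"
  then have A: "det A = 1" by (simp add: SL2_def)
  then obtain B where B: "B ** A = mat 1"
    by (metis invertible_det_nz invertible_def zero_neq_one)
  then have "det B = 1"
    using A by (metis det_I det_mul mult.right_neutral)
  with B show "\<exists>B\<in>carrier SL2. B \<otimes>\<^bsub>SL2\<^esub> A = \<one>\<^bsub>SL2\<^esub>"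
    by (auto simp: SL2_def)
qed (auto simp: SL2_def det_mul matrix_mul_assoc)

definition representations :: "('a, 'b) monoid_scheme \<Rightarrow> ('a \<Rightarrow> complex^2^2) set" where
  "representations G = hom G SL2"

definition character :: "('a, 'b) monoid_scheme \<Rightarrow> ('a \<Rightarrow> complex^2^2) \<Rightarrow> 'a \<Rightarrow> complex" where
  "character G \<rho> = (\<lambda>\<gamma>\<in>carrier G. trace (\<rho> \<gamma>))"

definition character_variety :: "('a, 'b) monoid_scheme \<Rightarrow> ('a \<Rightarrow> complex) set" where
  "character_variety G = character G ` representations G"

definition discrete_faithful :: "('a, 'b) monoid_scheme \<Rightarrow> ('a \<Rightarrow> complex^2^2) \<Rightarrow> bool" where
  "discrete_faithful G \<rho> \<longleftrightarrow>
     \<rho> \<in> representations G \<and> inj_on \<rho> (carrier G) \<and> discrete (\<rho> ` carrier G)"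


section \<open>Regular functions and algebraic components\<close>

text \<open>The \<open>\<complex>\<close>-algebra of functions on \<open>X\<close> generated by the functions in \<open>F\<close>.  As throughout,
  a function on a set \<open>X\<close> is represented by an extensional one (\<open>undefined\<close> off \<open>X\<close>), so that
  equality of such functions is equality on \<open>X\<close>.\<close>

inductive_set generated_algebra :: "'p set \<Rightarrow> ('p \<Rightarrow> complex) set \<Rightarrow> ('p \<Rightarrow> complex) set"
  for X :: "'p set" and F :: "('p \<Rightarrow> complex) set" where
  gen_const: "(\<lambda>x\<in>X. c) \<in> generated_algebra X F"
| gen_base: "f \<in> F \<Longrightarrow> restrict f X \<in> generated_algebra X F"
| gen_add: "f \<in> generated_algebra X F \<Longrightarrow> g \<in> generated_algebra X F \<Longrightarrow>
    (\<lambda>x\<in>X. f x + g x) \<in> generated_algebra X F"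
| gen_mult: "f \<in> generated_algebra X F \<Longrightarrow> g \<in> generated_algebra X F \<Longrightarrow>
    (\<lambda>x\<in>X. f x * g x) \<in> generated_algebra X F"

definition trace_fun :: "('a \<Rightarrow> complex) set \<Rightarrow> 'a \<Rightarrow> ('a \<Rightarrow> complex) \<Rightarrow> complex" where
  "trace_fun X \<gamma> = (\<lambda>x\<in>X. x \<gamma>)"

text \<open>The affine coordinates on the character variety are finitely many of the functions
  \<open>trace_fun X \<gamma>\<close>; by the trace identities in \<open>SL\<^sub>2(\<complex>)\<close> all the others are polynomials in
  these (for finitely generated \<open>G\<close>).  Hence \<open>\<complex>[X]\<close> is the algebra generated by all of them.\<close>

definition coordinate_ring ::
  "('a, 'b) monoid_scheme \<Rightarrow> ('a \<Rightarrow> complex) set \<Rightarrow> (('a \<Rightarrow> complex) \<Rightarrow> complex) set" where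
  "coordinate_ring G X = generated_algebra X (trace_fun X ` carrier G)"

definition algebraic_subset :: "('a, 'b) monoid_scheme \<Rightarrow> ('a \<Rightarrow> complex) set \<Rightarrow> bool" where
  "algebraic_subset G Z \<longleftrightarrow>
     (\<exists>F \<subseteq> coordinate_ring G (character_variety G).
        Z = {x \<in> character_variety G. \<forall>f\<in>F. f x = 0})"

definition irreducible_subset :: "('a, 'b) monoid_scheme \<Rightarrow> ('a \<Rightarrow> complex) set \<Rightarrow> bool" where
  "irreducible_subset G Z \<longleftrightarrow>
     algebraic_subset G Z \<and> Z \<noteq> {} \<and>
     (\<forall>Z1 Z2. algebraic_subset G Z1 \<and> algebraic_subset G Z2 \<and> Z = Z1 \<union> Z2 \<longrightarrow> Z = Z1 \<or> Z = Z2)"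

definition irreducible_component :: "('a, 'b) monoid_scheme \<Rightarrow> ('a \<Rightarrow> complex) set \<Rightarrow> bool" where
  "irreducible_component G Z \<longleftrightarrow>
     irreducible_subset G Z \<and> (\<forall>Z'. irreducible_subset G Z' \<and> Z \<subseteq> Z' \<longrightarrow> Z = Z')"

definition hyperbolic_curve :: "('a, 'b) monoid_scheme \<Rightarrow> ('a \<Rightarrow> complex) set \<Rightarrow> bool" where
  "hyperbolic_curve G X \<longleftrightarrow>
     irreducible_component G X \<and> (\<exists>\<rho>. discrete_faithful G \<rho> \<and> character G \<rho> \<in> X)"


section \<open>Bases of modules of functions\<close>

text \<open>\<open>B\<close> is a finite basis of \<open>M\<close> as a module over the ring \<open>S\<close>, where \<open>S\<close> and \<open>M\<close> consist of
  functions on \<open>X\<close> and \<open>S\<close> acts on \<open>M\<close> by pointwise multiplication.\<close>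

definition module_basis ::
  "'p set \<Rightarrow> ('p \<Rightarrow> complex) set \<Rightarrow> ('p \<Rightarrow> complex) set \<Rightarrow> ('p \<Rightarrow> complex) set \<Rightarrow> bool" where
  "module_basis X S M B \<longleftrightarrow>
     finite B \<and> B \<subseteq> M \<and>
     (\<forall>f\<in>M. \<exists>c \<in> B \<rightarrow> S. f = (\<lambda>x\<in>X. \<Sum>b\<in>B. c b x * b x)) \<and>
     (\<forall>c \<in> B \<rightarrow> S. (\<forall>x\<in>X. (\<Sum>b\<in>B. c b x * b x) = 0) \<longrightarrow> (\<forall>b\<in>B. \<forall>x\<in>X. c b x = 0))"


section \<open>The once-punctured torus bundle\<close>

datatype generator = Alpha | Beta | Tau

abbreviation (input) gen_word :: "generator \<Rightarrow> generator word" where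
  "gen_word g \<equiv> [(g, False)]"

definition piN_relations :: "(generator word \<times> generator word) set" where
  "piN_relations =
    (let a = gen_word Alpha; b = gen_word Beta; t = gen_word Tau;
         bab_inv = word_inv (b @ a @ b)
     in {(t @ a @ word_inv t, bab_inv),
         (t @ b @ word_inv t, b @ a @ bab_inv @ bab_inv @ bab_inv)})"

definition piN :: "generator word set monoid" where
  "piN = presented_group piN_relations"

definition piN_gen :: "generator \<Rightarrow> generator word set" where
  "piN_gen g = word_class piN_relations (gen_word g)"

definition commutator :: "('a, 'b) monoid_scheme \<Rightarrow> 'a \<Rightarrow> 'a \<Rightarrow> 'a" where
  "commutator G x y = x \<otimes>\<^bsub>G\<^esub> y \<otimes>\<^bsub>G\<^esub> inv\<^bsub>G\<^esub> x \<otimes>\<^bsub>G\<^esub> inv\<^bsub>G\<^esub> y"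

end

theory Submission
  imports Defs "HOL-Computational_Algebra.Polynomial"
begin

text \<open>
  Let \<open>x, y, z\<close> be the traces of \<open>\<alpha>, \<beta>, \<alpha>\<beta>\<close> under a representation. Taking traces in the two relations
  gives \<open>2x = yz\<close> and \<open>y = 0\<close> or \<open>z\<^sup>2(y\<^sup>2 - 2) = 8\<close>. A faithful character has \<open>y \<noteq> 0\<close>, as otherwise
  \<open>\<alpha>\<^sup>4\<close> is killed, and \<open>l \<noteq> 2\<close>, as otherwise \<open>\<alpha>\<close> and \<open>\<beta>\<close> commute. For characters with \<open>y \<noteq> 0\<close> and
  \<open>l \<noteq> 2\<close>, the relations are linear in the traces of \<open>\<tau>, \<alpha>\<tau>, \<beta>\<tau>, \<alpha>\<beta>\<tau>\<close> and determine these up to a factor,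
  and Fricke's identity yields \<open>tr(\<alpha>\<beta>\<tau>)\<^sup>2 = -z\<^sup>2\<close>. Hence \<open>tr(\<alpha>\<beta>\<tau>) = \<eta>z\<close> with \<open>\<eta> = \<plusminus>\<i>\<close>, the sign of \<open>\<eta>\<close>
  distinguishing the two hyperbolic curves, and every trace is a polynomial in \<open>y\<close> and \<open>z\<close>. Each
  hyperbolic curve is the Zariski closure of the characters with one value of \<open>\<eta>\<close>, and these fill, up to
  finitely many points, the rational curve \<open>z\<^sup>2(y\<^sup>2 - 2) = 8\<close>. On it \<open>l = y\<^sup>2 + z\<^sup>2/2 - 4\<close>, so
  \<open>z\<^sup>4 = 2(l + 2)z\<^sup>2 - 16\<close> and \<open>y\<^sup>2 = l + 4 - z\<^sup>2/2\<close>, which gives spanning. A generic fibre of \<open>l\<close> has the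
  eight points obtained from two values of \<open>z\<^sup>2\<close> by choosing the signs of \<open>y\<close> and \<open>z\<close>, which gives
  independence.
\<close>

section \<open>Two by two matrices of determinant 1\<close>

text \<open>Coordinates with respect to 1, A, B, AB, the scalars entering as scalar matrices. For
  determinant 1 the span of these four is closed under multiplication by A and B, so words in A and
  B have coordinates that are polynomials in the three traces.\<close>

definition comb :: "complex^2^2 \<Rightarrow> complex^2^2 \<Rightarrow> complex \<Rightarrow> complex \<Rightarrow> complex \<Rightarrow> complex \<Rightarrow> complex^2^2" where
  "comb A B p q r s = mat p + mat q ** A + mat r ** B + mat s ** (A ** B)"

lemmas mat2_simps = matrix_matrix_mult_def vec_eq_iff forall_2 sum_2 det_2 trace_def mat_def

lemma comb_nth:
  "comb A B p q r s $ 1 $ 1 = p + q * A$1$1 + r * B$1$1 + s * (A$1$1 * B$1$1 + A$1$2 * B$2$1)"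
  "comb A B p q r s $ 1 $ 2 = q * A$1$2 + r * B$1$2 + s * (A$1$1 * B$1$2 + A$1$2 * B$2$2)"
  "comb A B p q r s $ 2 $ 1 = q * A$2$1 + r * B$2$1 + s * (A$2$1 * B$1$1 + A$2$2 * B$2$1)"
  "comb A B p q r s $ 2 $ 2 = p + q * A$2$2 + r * B$2$2 + s * (A$2$1 * B$1$2 + A$2$2 * B$2$2)"
  by (simp_all add: comb_def mat2_simps)

text \<open>Cayley-Hamilton, A^2 = tr(A) A - 1, removes the square of A.\<close>

lemma comb_mult_A_left:
  fixes A B :: "complex^2^2"
  assumes "det A = 1"
  shows "A ** comb A B p q r s =
    comb A B (- q) (p + trace A * q) (- s) (r + trace A * s)"
proof -
  have "A$1$1 * A$2$2 - A$1$2 * A$2$1 = 1" using assms by (simp add: det_2)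
  then show ?thesis
    by (simp only: vec_eq_iff forall_2 comb_nth) (simp add: matrix_matrix_mult_def sum_2 trace_def comb_nth, intro conjI; algebra)
qed

text \<open>The polarized Cayley-Hamilton identity BA = (tr(AB) - tr(A) tr(B)) + tr(B) A + tr(A) B -
  AB restores the order of the factors, and BAB = tr(AB) B - tr(A) + A handles the last
  coordinate.\<close>

lemma comb_mult_B_left:
  fixes A B :: "complex^2^2"
  assumes "det A = 1" "det B = 1"
  shows "B ** comb A B p q r s =
    comb A B (q * (trace (A ** B) - trace A * trace B) - r - trace A * s) (trace B * q + s)
      (p + trace A * q + trace B * r + trace (A ** B) * s) (- q)"
proof -
  have "A$1$1 * A$2$2 - A$1$2 * A$2$1 = 1" "B$1$1 * B$2$2 - B$1$2 * B$2$1 = 1" using assms by (simp_all add: det_2)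
  then show ?thesis
    by (simp only: vec_eq_iff forall_2 comb_nth) (simp add: matrix_matrix_mult_def sum_2 trace_def comb_nth, intro conjI; algebra)
qed

lemma comb_mult_A_right:
  fixes A B :: "complex^2^2"
  assumes "det A = 1" "det B = 1"
  shows "comb A B p q r s ** A =
    comb A B (- q + r * (trace (A ** B) - trace A * trace B) - trace B * s)
      (p + trace A * q + trace B * r + trace (A ** B) * s) (trace A * r + s) (- r)"
proof -
  have "A$1$1 * A$2$2 - A$1$2 * A$2$1 = 1" "B$1$1 * B$2$2 - B$1$2 * B$2$1 = 1" using assms by (simp_all add: det_2)
  then show ?thesis
    by (simp only: vec_eq_iff forall_2 comb_nth) (simp add: matrix_matrix_mult_def sum_2 trace_def comb_nth, intro conjI; algebra)
qed

lemma comb_mult_B_right: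
  fixes A B :: "complex^2^2"
  assumes "det B = 1"
  shows "comb A B p q r s ** B =
    comb A B (- r) (- s) (p + trace B * r) (q + trace B * s)"
proof -
  have "B$1$1 * B$2$2 - B$1$2 * B$2$1 = 1" using assms by (simp_all add: det_2)
  then show ?thesis
    by (simp only: vec_eq_iff forall_2 comb_nth) (simp add: matrix_matrix_mult_def sum_2 trace_def comb_nth, intro conjI; algebra)
qed

lemma det_comb:
  fixes A B :: "complex^2^2"
  assumes "det A = 1" "det B = 1"
  shows "det (comb A B p q r s) = p^2 + q^2 + r^2 + s^2 + trace A * p * q + trace B * p * r
    + trace (A ** B) * p * s + (trace A * trace B - trace (A ** B)) * q * r + trace B * q * s + trace A * r * s"
proof -
  have "A$1$1 * A$2$2 - A$1$2 * A$2$1 = 1" "B$1$1 * B$2$2 - B$1$2 * B$2$1 = 1" using assms by (simp_all add: det_2)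
  then show ?thesis
    by (simp add: mat2_simps comb_nth) algebra
qed

lemma trace_comb_mult:
  fixes A B T :: "complex^2^2"
  shows "trace (comb A B p q r s ** T) = p * trace T + q * trace (A ** T) + r * trace (B ** T) + s * trace (A ** B ** T)"
  by (simp add: mat2_simps comb_nth) algebra

text \<open>Fricke's quadratic equation for the trace of a triple product; its other root is
  tr(ACB).\<close>

lemma fricke:
  fixes A B C :: "complex^2^2"
  assumes "det A = 1" "det B = 1" "det C = 1"
  defines "a \<equiv> trace A" and "b \<equiv> trace B" and "c \<equiv> trace C"
    and "ab \<equiv> trace (A ** B)" and "ac \<equiv> trace (A ** C)" and "bc \<equiv> trace (B ** C)" and "t \<equiv> trace (A ** B ** C)"
  shows "t\<^sup>2 - (a * bc + b * ac + c * ab - a * b * c) * t +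
    (a\<^sup>2 + b\<^sup>2 + c\<^sup>2 + ab\<^sup>2 + bc\<^sup>2 + ac\<^sup>2 - a * b * ab - b * c * bc - a * c * ac + ab * bc * ac - 4) = 0"
proof -
  have "A$1$1 * A$2$2 - A$1$2 * A$2$1 = 1" "B$1$1 * B$2$2 - B$1$2 * B$2$1 = 1"
     "C$1$1 * C$2$2 - C$1$2 * C$2$1 = 1"
    using assms by (simp_all add: det_2)
  then show ?thesis unfolding assms(4-)
    by (simp add: mat2_simps comb_nth) algebra
qed

text \<open>Cayley-Hamilton at determinant 1: inverses stay in the span of 1 and A.\<close>

lemma inverse_2_2:
  fixes A A' :: "complex^2^2"
  assumes "det A = 1" and "A ** A' = mat 1 \<or> A' ** A = mat 1"
  shows "A' = mat (trace A) - A" and "A ** A' = mat 1" and "A' ** A = mat 1"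
proof -
  have "A ** A' = mat 1 \<and> A' ** A = mat 1"
    using assms(2) matrix_left_right_inverse by blast
  then show 1: "A ** A' = mat 1" "A' ** A = mat 1" by blast+
  have "A$1$1 * A$2$2 - A$1$2 * A$2$1 = 1" using assms by (simp add: det_2)
  then have "(mat (trace A) - A) ** A = mat 1"
    by (simp add: mat2_simps, intro conjI; algebra)
  then have "(mat (trace A) - A) ** (A ** A') = A'"
    by (metis matrix_mul_assoc matrix_mul_lid)
  with 1 show "A' = mat (trace A) - A" by (metis matrix_mul_rid)
qed

lemma trace_commutator:
  fixes A B A' B' :: "complex^2^2"
  assumes "det A = 1" "det B = 1" "A ** A' = mat 1" "B ** B' = mat 1"
  shows "trace (A ** B ** A' ** B') = (trace A)\<^sup>2 + (trace B)\<^sup>2 + (trace (A ** B))\<^sup>2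
    - trace A * trace B * trace (A ** B) - 2"
proof -
  have inv: "A' = mat (trace A) - A" "B' = mat (trace B) - B"
    using assms inverse_2_2 by blast+
  have "A$1$1 * A$2$2 - A$1$2 * A$2$1 = 1" "B$1$1 * B$2$2 - B$1$2 * B$2$1 = 1"
    using assms by (simp_all add: det_2)
  then show ?thesis
    unfolding inv by (simp add: mat2_simps) algebra
qed

lemma trace_conjugate:
  fixes T A M :: "complex^2^2"
  assumes "det T = 1" "T ** A = M ** T"
  shows "trace M = trace A"
proof -
  obtain T' where T': "T ** T' = mat 1"
    using assms(1) invertible_det_nz[of T] by (auto simp: invertible_def)
  then have "M = T ** A ** T'"
    by (metis assms(2) matrix_mul_assoc matrix_mul_rid)
  then have "trace M = trace (T' ** (T ** A))"
    by (metis trace_mul_sym)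
  then show ?thesis
    using T' by (metis matrix_left_right_inverse matrix_mul_assoc matrix_mul_lid)
qed

text \<open>The matrices A - e and B - f are nilpotent and their product has trace 0. Two such
  nilpotents are linearly dependent and hence commute.\<close>

lemma commute_of_trace_2:
  fixes A B :: "complex^2^2"
  assumes "det A = 1" "det B = 1" "trace A = 2 * e" "trace B = 2 * f"
    and "trace (A ** B) = 2 * e * f" "e\<^sup>2 = 1" "f\<^sup>2 = 1"
  shows "A ** B = B ** A"
proof -
  have d: "A$1$1 * A$2$2 - A$1$2 * A$2$1 = 1" "B$1$1 * B$2$2 - B$1$2 * B$2$1 = 1"
    using assms by (simp_all add: det_2)
  have t: "A$1$1 + A$2$2 = 2 * e" "B$1$1 + B$2$2 = 2 * f"
    "A$1$1 * B$1$1 + A$1$2 * B$2$1 + (A$2$1 * B$1$2 + A$2$2 * B$2$2) = 2 * e * f"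
    using assms by (simp_all add: mat2_simps)
  \<comment> \<open>The three squares are those of the 2 by 2 minors formed from the entries (1,1),
    (1,2), (2,1) of A - e and B - f.\<close>
  have "(A$1$2 * B$2$1 - A$2$1 * B$1$2)\<^sup>2 = 0"
    using d t assms(6,7) by algebra
  moreover have "((A$1$1 - e) * B$1$2 - A$1$2 * (B$1$1 - f))\<^sup>2 = 0"
    using d t assms(6,7) by algebra
  moreover have "((A$1$1 - e) * B$2$1 - A$2$1 * (B$1$1 - f))\<^sup>2 = 0"
    using d t assms(6,7) by algebra
  ultimately have "A$1$2 * B$2$1 = A$2$1 * B$1$2"
    "(A$1$1 - e) * B$1$2 = A$1$2 * (B$1$1 - f)" "(A$1$1 - e) * B$2$1 = A$2$1 * (B$1$1 - f)"
    by simp_all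
  with t show ?thesis
    by (simp add: mat2_simps, intro conjI; algebra)
qed

section \<open>Homomorphisms from a presented group\<close>

definition word_eval :: "('h, 'm) monoid_scheme \<Rightarrow> ('g \<Rightarrow> 'h) \<Rightarrow> 'g word \<Rightarrow> 'h" where
  "word_eval H f w =
     foldr (\<lambda>(g, e) h. (if e then inv\<^bsub>H\<^esub> f g else f g) \<otimes>\<^bsub>H\<^esub> h) w \<one>\<^bsub>H\<^esub>"

lemma word_eval_simps [simp]:
  "word_eval H f [] = \<one>\<^bsub>H\<^esub>"
  "word_eval H f ((g, e) # w) = (if e then inv\<^bsub>H\<^esub> f g else f g) \<otimes>\<^bsub>H\<^esub> word_eval H f w"
  by (simp_all add: word_eval_def)

context group
begin

lemma word_eval_closed [simp]:
  assumes "\<And>g. f g \<in> carrier G"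
  shows "word_eval G f w \<in> carrier G"
  using assms by (induction w) auto

lemma word_eval_append:
  assumes "\<And>g. f g \<in> carrier G"
  shows "word_eval G f (u @ v) = word_eval G f u \<otimes> word_eval G f v"
  using assms by (induction u) (auto simp: m_assoc)

lemma word_eval_word_eq:
  assumes "\<And>g. f g \<in> carrier G" "\<And>u v. (u, v) \<in> R \<Longrightarrow> word_eval G f u = word_eval G f v"
    and "word_eq R u v"
  shows "word_eval G f u = word_eval G f v"
  using assms(3)
proof induction
  case (word_eq_cancel g e)
  show ?case using assms(1) by simp
qed (simp_all add: assms word_eval_append)

text \<open>Equivalent words have equal values, so evaluating an arbitrary representative of a class
  is well defined.\<close>

lemma presented_group_hom_exists:
  assumes "\<And>g. f g \<in> carrier G" "\<And>u v. (u, v) \<in> R \<Longrightarrow> word_eval G f u = word_eval G f v"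
  obtains \<rho> where "\<rho> \<in> hom (presented_group R) G"
    and "\<And>w. \<rho> (word_class R w) = word_eval G f w"
proof
  define \<rho> where "\<rho> X = word_eval G f (SOME w. w \<in> X)" for X
  show \<rho>: "\<rho> (word_class R w) = word_eval G f w" for w
  proof -
    have "(SOME v. v \<in> word_class R w) \<in> word_class R w"
      by (rule someI[of _ w]) (simp add: word_class_def word_eq_refl)
    then show ?thesis
      using word_eval_word_eq[OF assms] by (metis \<rho>_def mem_Collect_eq word_class_def)
  qed
  show "\<rho> \<in> hom (presented_group R) G"
  proof (rule homI)
    fix X assume "X \<in> carrier (presented_group R)"
    then show "\<rho> X \<in> carrier G" by (auto simp: presented_group_def \<rho> assms)
  next
    fix X Y assume "X \<in> carrier (presented_group R)" "Y \<in> carrier (presented_group R)"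
    then obtain u v where "X = word_class R u" "Y = word_class R v"
      by (auto simp: presented_group_def)
    then show "\<rho> (X \<otimes>\<^bsub>presented_group R\<^esub> Y) = \<rho> X \<otimes> \<rho> Y"
      by (simp add: presented_group_mult \<rho> word_eval_append assms)
  qed
qed

text \<open>The new relations are free of inverses and contain t once on each side. For matrices
  they are therefore linear in the image of t.\<close>

lemma bundle_relations_iff:
  assumes [simp]: "a \<in> carrier G" "b \<in> carrier G" "t \<in> carrier G"
  defines "w \<equiv> b \<otimes> a \<otimes> b"
  shows "t \<otimes> a \<otimes> inv t = inv w \<and> t \<otimes> b \<otimes> inv t = b \<otimes> a \<otimes> inv w \<otimes> inv w \<otimes> inv w \<longleftrightarrow>
    w \<otimes> t \<otimes> a = t \<and> t \<otimes> b = b \<otimes> a \<otimes> t \<otimes> a \<otimes> a \<otimes> a"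
proof -
  have [simp]: "w \<in> carrier G" by (simp add: w_def)
  have 1: "t \<otimes> a \<otimes> inv t = inv w \<longleftrightarrow> w \<otimes> t \<otimes> a = t"
    by (smt (verit, ccfv_threshold) assms(1,3) \<open>w \<in> carrier G\<close> inv_closed inv_equality inv_solve_right' l_inv m_assoc m_closed r_inv r_one l_one inv_inv)
  have 2: "t \<otimes> b \<otimes> inv t = b \<otimes> a \<otimes> inv w \<otimes> inv w \<otimes> inv w \<longleftrightarrow> t \<otimes> b = b \<otimes> a \<otimes> t \<otimes> a \<otimes> a \<otimes> a"
    if "t \<otimes> a \<otimes> inv t = inv w"
  proof -
    \<comment> \<open>By the first relation a factor \<open>inv w\<close> in front of t becomes a
      factor a behind it.\<close>
    have 3: "inv w \<otimes> t = t \<otimes> a"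
      by (simp add: that[symmetric] m_assoc)
    have 4: "inv w \<otimes> (t \<otimes> c) = t \<otimes> (a \<otimes> c)" if "c \<in> carrier G" for c
      using 3 that by (metis \<open>w \<in> carrier G\<close> assms(1,3) inv_closed m_assoc)
    have "t \<otimes> b \<otimes> inv t = b \<otimes> a \<otimes> inv w \<otimes> inv w \<otimes> inv w \<longleftrightarrow>
      t \<otimes> b = b \<otimes> a \<otimes> inv w \<otimes> inv w \<otimes> inv w \<otimes> t"
      by (metis (no_types, lifting) \<open>w \<in> carrier G\<close> assms(1-3) inv_closed inv_solve_right' m_closed)
    also have "b \<otimes> a \<otimes> inv w \<otimes> inv w \<otimes> inv w \<otimes> t = b \<otimes> a \<otimes> t \<otimes> a \<otimes> a \<otimes> a"
      by (simp add: m_assoc 3 4)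
    finally show ?thesis .
  qed
  show ?thesis using 1 2 by blast
qed

end

lemma word_class_closed [simp]: "word_class R w \<in> carrier (presented_group R)"
  by (simp add: presented_group_def)

lemma inv_word_class:
  "inv\<^bsub>presented_group R\<^esub> word_class R w = word_class R (word_inv w)"
proof -
  interpret group "presented_group R" by (rule group_presented_group)
  have "word_class R (word_inv w) \<otimes>\<^bsub>presented_group R\<^esub> word_class R w = \<one>\<^bsub>presented_group R\<^esub>"
    by (simp add: presented_group_mult word_class_eq_iff word_eq_inv)
      (simp add: presented_group_def word_class_eq_iff word_eq_inv)
  then show ?thesis by (simp add: inv_equality)
qed

interpretation piN: group piN
  unfolding piN_def by (rule group_presented_group)

lemma piN_gen_closed [simp]: "piN_gen g \<in> carrier piN"
  by (simp add: piN_gen_def piN_def)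

lemma piN_gen_relations:
  defines "a \<equiv> piN_gen Alpha" and "b \<equiv> piN_gen Beta" and "t \<equiv> piN_gen Tau"
  shows "b \<otimes>\<^bsub>piN\<^esub> a \<otimes>\<^bsub>piN\<^esub> b \<otimes>\<^bsub>piN\<^esub> t \<otimes>\<^bsub>piN\<^esub> a = t"
    and "t \<otimes>\<^bsub>piN\<^esub> b = b \<otimes>\<^bsub>piN\<^esub> a \<otimes>\<^bsub>piN\<^esub> t \<otimes>\<^bsub>piN\<^esub> a \<otimes>\<^bsub>piN\<^esub> a \<otimes>\<^bsub>piN\<^esub> a"
proof -
  let ?R = piN_relations
  have [simp]: "a \<in> carrier piN" "b \<in> carrier piN" "t \<in> carrier piN"
    by (simp_all add: a_def b_def t_def)
  let ?w = "b \<otimes>\<^bsub>piN\<^esub> a \<otimes>\<^bsub>piN\<^esub> b"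
  have "t \<otimes>\<^bsub>piN\<^esub> a \<otimes>\<^bsub>piN\<^esub> inv\<^bsub>piN\<^esub> t = inv\<^bsub>piN\<^esub> ?w"
    "t \<otimes>\<^bsub>piN\<^esub> b \<otimes>\<^bsub>piN\<^esub> inv\<^bsub>piN\<^esub> t =
       b \<otimes>\<^bsub>piN\<^esub> a \<otimes>\<^bsub>piN\<^esub> inv\<^bsub>piN\<^esub> ?w \<otimes>\<^bsub>piN\<^esub> inv\<^bsub>piN\<^esub> ?w \<otimes>\<^bsub>piN\<^esub> inv\<^bsub>piN\<^esub> ?w"
    unfolding a_def b_def t_def piN_gen_def piN_def inv_word_class presented_group_mult word_class_eq_iff
    by (rule word_eq_rel, simp add: piN_relations_def Let_def word_inv_def)+
  then show "?w \<otimes>\<^bsub>piN\<^esub> t \<otimes>\<^bsub>piN\<^esub> a = t"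
    and "t \<otimes>\<^bsub>piN\<^esub> b = b \<otimes>\<^bsub>piN\<^esub> a \<otimes>\<^bsub>piN\<^esub> t \<otimes>\<^bsub>piN\<^esub> a \<otimes>\<^bsub>piN\<^esub> a \<otimes>\<^bsub>piN\<^esub> a"
    using piN.bundle_relations_iff[of a b t] by simp_all
qed

lemma (in group) piN_hom_exists:
  assumes [simp]: "a \<in> carrier G" "b \<in> carrier G" "t \<in> carrier G"
    and "b \<otimes> a \<otimes> b \<otimes> t \<otimes> a = t" "t \<otimes> b = b \<otimes> a \<otimes> t \<otimes> a \<otimes> a \<otimes> a"
  obtains \<rho> where "\<rho> \<in> hom piN G"
    "\<rho> (piN_gen Alpha) = a" "\<rho> (piN_gen Beta) = b" "\<rho> (piN_gen Tau) = t"
proof -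
  define f where "f g = (case g of Alpha \<Rightarrow> a | Beta \<Rightarrow> b | Tau \<Rightarrow> t)" for g
  have f [simp]: "f Alpha = a" "f Beta = b" "f Tau = t" by (simp_all add: f_def)
  have closed: "f g \<in> carrier G" for g by (cases g) simp_all
  have "t \<otimes> a \<otimes> inv t = inv (b \<otimes> a \<otimes> b)"
    "t \<otimes> b \<otimes> inv t = b \<otimes> a \<otimes> inv (b \<otimes> a \<otimes> b) \<otimes> inv (b \<otimes> a \<otimes> b) \<otimes> inv (b \<otimes> a \<otimes> b)"
    using bundle_relations_iff[of a b t] assms by simp_all
  then have "word_eval G f u = word_eval G f v" if "(u, v) \<in> piN_relations" for u v
    using that by (auto simp: piN_relations_def Let_def word_inv_def inv_mult_group m_assoc)
  from presented_group_hom_exists[of f, OF closed this] obtain \<rho>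
    where \<rho>: "\<rho> \<in> hom piN G" "\<And>w. \<rho> (word_class piN_relations w) = word_eval G f w"
    unfolding piN_def by blast
  show thesis
    by (rule that[OF \<rho>(1)]) (simp_all add: piN_gen_def \<rho>(2))
qed

lemma piN_induct [consumes 1, case_names one gen inv]:
  assumes "\<gamma> \<in> carrier piN"
    and "P \<one>\<^bsub>piN\<^esub>"
    and "\<And>g \<delta>. \<delta> \<in> carrier piN \<Longrightarrow> P \<delta> \<Longrightarrow> P (piN_gen g \<otimes>\<^bsub>piN\<^esub> \<delta>)"
    and "\<And>g \<delta>. \<delta> \<in> carrier piN \<Longrightarrow> P \<delta> \<Longrightarrow> P (inv\<^bsub>piN\<^esub> piN_gen g \<otimes>\<^bsub>piN\<^esub> \<delta>)"
  shows "P \<gamma>"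
proof -
  let ?C = "word_class piN_relations"
  have "P (?C w)" for w
  proof (induction w)
    case Nil
    then show ?case using assms(2) by (simp add: piN_def presented_group_def)
  next
    case (Cons s w)
    obtain g e where s: "s = (g, e)" by force
    have "?C (s # w) = (if e then inv\<^bsub>piN\<^esub> piN_gen g else piN_gen g) \<otimes>\<^bsub>piN\<^esub> ?C w"
      by (simp add: s piN_gen_def piN_def inv_word_class presented_group_mult word_inv_def)
    then show ?case
      using Cons assms(3,4) by (auto simp: piN_def)
  qed
  then show ?thesis using assms(1) by (auto simp: piN_def presented_group_def)
qed

section \<open>Traces of a representation of the bundle group\<close>

text \<open>The method \<open>algebra\<close> often fails to use a hypothesis that is not of the form \<open>p = 0\<close>.\<close>

lemmas diff_eq_0I = right_minus_eq[THEN iffD2]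

lemma trace_comb:
  "trace (comb A B p q r s) = 2 * p + q * trace A + r * trace B + s * trace (A ** B)"
  by (simp add: mat2_simps comb_nth) algebra

lemma comb_basis:
  "mat 1 = comb A B 1 0 0 0" "A = comb A B 0 1 0 0" "B = comb A B 0 0 1 0" "A ** B = comb A B 0 0 0 1"
  by (simp_all add: vec_eq_iff forall_2 comb_nth) (simp_all add: mat2_simps)

lemma mat_diff_comb: "mat c - comb A B p q r s = comb A B (c - p) (- q) (- r) (- s)"
  by (simp add: vec_eq_iff forall_2 comb_nth) (simp add: mat2_simps)

lemma comb_eqI: "p = p' \<Longrightarrow> q = q' \<Longrightarrow> r = r' \<Longrightarrow> s = s' \<Longrightarrow> comb A B p q r s = comb A B p' q' r' s'"
  by simp

text \<open>Cayley-Hamilton gives M^3 = (tr(M)^2 - 1) M - tr(M).\<close>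

lemma trace_mult_cube:
  fixes M N :: "complex^2^2"
  assumes "det M = 1"
  shows "trace (N ** M ** M ** M) = ((trace M)\<^sup>2 - 1) * trace (N ** M) - trace M * trace N"
proof -
  have "M$1$1 * M$2$2 - M$1$2 * M$2$1 = 1" using assms by (simp add: det_2)
  then show ?thesis by (simp add: mat2_simps) algebra
qed

text \<open>The images of \<alpha>, \<beta>, \<tau> under a representation, with the relations in
  their inverse-free form.\<close>

locale bundle_triple =
  fixes A B T :: "complex^2^2"
  assumes det [simp]: "det A = 1" "det B = 1" "det T = 1"
    and rel_A: "B ** A ** B ** T ** A = T"
    and rel_B: "T ** B = B ** A ** T ** A ** A ** A"
begin

abbreviation "x \<equiv> trace A"
abbreviation "y \<equiv> trace B"
abbreviation "z \<equiv> trace (A ** B)"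
abbreviation "t \<equiv> trace (A ** B ** T)"
text \<open>By \<open>trace_commutator\<close> this is the trace of the commutator of A and
  B.\<close>

abbreviation "l \<equiv> x\<^sup>2 + y\<^sup>2 + z\<^sup>2 - x * y * z - 2"
text \<open>The inverse of BAB, found as tr(BAB) - BAB; by the first relation it is also the
  conjugate of A by T.\<close>

abbreviation "M \<equiv> comb A B (y * z) (- 1) (- z) 0"

lemma B_A: "B ** A = comb A B (z - x * y) y x (- 1)"
  using comb_mult_B_left[of A B 0 1 0 0] by (simp flip: comb_basis)

lemma B_A_B: "B ** A ** B = comb A B (- x) 1 z 0"
  using comb_mult_B_right[of B A "z - x * y" y x "- 1"] by (simp add: B_A)

lemma det_B_A_B: "det (B ** A ** B) = 1"
  by (simp add: det_mul)

lemma M_inverse: "M ** (B ** A ** B) = mat 1" "(B ** A ** B) ** M = mat 1"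
proof -
  obtain W' where W': "(B ** A ** B) ** W' = mat 1"
    using det_B_A_B invertible_det_nz[of "B ** A ** B"] by (auto simp: invertible_def)
  note inv = inverse_2_2[OF det_B_A_B disjI1[OF W']]
  have "mat (trace (B ** A ** B)) - B ** A ** B = M"
    by (simp add: B_A_B trace_comb mat_diff_comb algebra_simps)
  with inv show "M ** (B ** A ** B) = mat 1" "(B ** A ** B) ** M = mat 1" by simp_all
qed

lemma det_M: "det M = 1"
  using arg_cong[OF M_inverse(1), of det] by (simp add: det_mul)

lemma T_A: "T ** A = M ** T"
proof -
  have "T ** A = M ** (B ** A ** B) ** (T ** A)"
    unfolding M_inverse(1) by simp
  also have "\<dots> = M ** (B ** A ** B ** T ** A)"
    unfolding matrix_mul_assoc ..
  finally show ?thesis unfolding rel_A .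
qed

lemma T_B: "T ** B = B ** A ** M ** M ** M ** T"
proof -
  have "N ** T ** A = N ** M ** T" for N
    using T_A by (metis matrix_mul_assoc)
  from this[of "B ** A"] this[of "B ** A ** M"] this[of "B ** A ** M ** M"]
  show ?thesis by (simp only: rel_B)
qed

text \<open>A and M are conjugate, and tr(M) = yz - x.\<close>

lemma two_x: "2 * x = y * z"
  using trace_conjugate[OF det(3) T_A] by (simp add: trace_comb)

lemma trace_M: "trace M = x"
  using trace_conjugate[OF det(3) T_A] .

text \<open>B is conjugate to BAM^3. As MBA is the inverse of B, tr(BAM) = y, and
  \<open>trace_mult_cube\<close> then evaluates tr(BAM^3).\<close>

lemma two_y: "2 * y = x\<^sup>2 * y - x * z"
proof -
  have B_A_M: "B ** A ** M = comb A B ((y * z - x) * (z - x * y) + x * z) (y * (y * z - x) - z)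
      (1 + x * (y * z - x) - z\<^sup>2) (x - y * z)"
    unfolding matrix_mul_assoc[symmetric] comb_mult_A_left[OF det(1)] comb_mult_B_left[OF det(1,2)]
    by (intro comb_eqI) (simp_all add: algebra_simps power2_eq_square)
  have "trace (B ** A ** M) = y"
    unfolding B_A_M trace_comb by (simp add: algebra_simps power2_eq_square)
  then have "trace (B ** A ** M ** M ** M) = (x\<^sup>2 - 1) * y - x * z"
    unfolding trace_mult_cube[OF det_M] trace_M by (simp add: trace_mul_sym[of B A])
  then show ?thesis
    using trace_conjugate[OF det(3) T_B] by algebra
qed

lemma curve: "y = 0 \<or> z\<^sup>2 * (y\<^sup>2 - 2) = 8"
proof -
  have "y * (z\<^sup>2 * (y\<^sup>2 - 2) - 8) = 0"
    using two_x two_y by algebra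
  then show ?thesis by auto
qed

text \<open>Evaluating tr(ATA) once as tr(AMT) and once as tr(A^2 T) gives a linear relation in
  which tr(AT) cancels.\<close>

lemma two_trace_T: "2 * trace T = z * t"
proof -
  have "A ** M = comb A B 1 x 0 (- z)"
    unfolding comb_mult_A_left[OF det(1)] by (intro comb_eqI) (simp_all flip: two_x)
  then have "A ** (T ** A) = comb A B 1 x 0 (- z) ** T"
    by (simp add: T_A matrix_mul_assoc)
  moreover have "A ** A = comb A B (- 1) x 0 0"
    using comb_mult_A_left[OF det(1), of B 0 1 0 0] by (simp flip: comb_basis)
  moreover have "trace (A ** (T ** A)) = trace (A ** A ** T)"
    by (metis matrix_mul_assoc trace_mul_sym)
  ultimately show ?thesis
    by (simp add: trace_comb_mult)
qed

lemma two_trace_A_T: "2 * trace (A ** T) = 2 * x * trace T - z * trace (B ** T)"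
proof -
  have "trace (A ** T) = trace (M ** T)"
    by (metis T_A trace_mul_sym)
  then show ?thesis
    by (simp add: trace_comb_mult flip: two_x)
qed

text \<open>Cyclicity turns the trace of the second relation into tr(A^3 BA T), and A^3 BA is
  expanded in 1, A, B, AB.\<close>

lemma two_trace_B_T: "2 * trace (B ** T) = (x\<^sup>2 * z - z - x * y) * trace (A ** T) + (y - x * z) * trace T + x * t"
proof -
  have "trace (B ** T) = trace (B ** A ** T ** A ** A ** A)"
    by (metis rel_B trace_mul_sym)
  also have "\<dots> = trace ((B ** A ** T) ** (A ** A ** A))"
    unfolding matrix_mul_assoc ..
  also have "\<dots> = trace (A ** (A ** (A ** (B ** A))) ** T)"
    by (subst trace_mul_sym) (simp only: matrix_mul_assoc)
  also have "A ** (A ** (A ** (B ** A))) = comb A B (y - x * z) (x\<^sup>2 * z - z - x * y) (- 1) x"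
    unfolding B_A comb_mult_A_left[OF det(1)]
    by (intro comb_eqI) (simp_all add: algebra_simps power2_eq_square)
  finally show ?thesis
    unfolding trace_comb_mult by simp
qed

section \<open>The traces involving \<open>T\<close> when \<open>y\<close> is nonzero and
  \<open>l\<close> is not 2\<close>

context
  assumes y_nz: "y \<noteq> 0" and l_ne_2: "l \<noteq> 2"
begin

lemma curve': "z\<^sup>2 * (y\<^sup>2 - 2) = 8"
  using curve y_nz by blast

lemma z_nz: "z \<noteq> 0"
  using curve' by auto

text \<open>Elimination of tr(T) and tr(AT) from the three linear relations above, modulo the
  equation of the curve.\<close>

lemma trace_B_T: "2 * z * trace (B ** T) = (z\<^sup>2 - 2) * y * t"
proof -
  \<comment> \<open>Halving y and t gives x = hz and tr(T) = zs, so that no denominators enter the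
    elimination.\<close>
  define h where "h = y / 2"
  define s where "s = t / 2"
  have y: "y = 2 * h" and t: "t = 2 * s" by (simp_all add: h_def s_def)
  have x: "x = h * z" and t0: "trace T = z * s"
    using two_x two_trace_T by (simp_all add: y t)
  have t1: "2 * trace (A ** T) = 2 * h * z\<^sup>2 * s - z * trace (B ** T)"
    using two_trace_A_T unfolding x t0 by (simp add: power2_eq_square)
  have "2 * (z\<^sup>2 * (2 * h\<^sup>2 - 1)) = 2 * 4" using curve' by (simp add: y power_mult_distrib algebra_simps)
  then have c: "z\<^sup>2 * (2 * h\<^sup>2 - 1) = 4" by simp
  \<comment> \<open>Up to the factor 2z this is the coefficient of tr(AT) in
    \<open>two_trace_B_T\<close>, reduced by the curve equation.\<close>
  have "2 * (z * (x\<^sup>2 * z - z - x * y)) = z ^ 4 - 8"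
    unfolding x y using c[THEN diff_eq_0I] by algebra
  moreover have "2 * z * (2 * trace (B ** T)) = 2 * (z * (x\<^sup>2 * z - z - x * y)) * trace (A ** T)
      + 2 * z * ((2 * h - h * z * z) * (z * s) + h * z * (2 * s))"
    using two_trace_B_T unfolding x y t0 t by algebra
  ultimately have "2 * z * (2 * trace (B ** T)) = (z ^ 4 - 8) * trace (A ** T)
      + 2 * z * ((2 * h - h * z * z) * (z * s) + h * z * (2 * s))" by simp
  with t1 have "z ^ 4 * (z * trace (B ** T) - 2 * h * s * (z\<^sup>2 - 2)) = 0"
    by algebra
  then show ?thesis using z_nz by (simp add: y t mult_ac)
qed

lemma trace_A_T: "2 * trace (A ** T) = y * t"
proof -
  have "4 * trace (A ** T) = 2 * y * t"
    using two_trace_A_T trace_B_T two_x two_trace_T by algebra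
  then show ?thesis by simp
qed

text \<open>With the other traces of A, B, T expressed through y, z and t, Fricke's equation becomes
  (l - 2)(t^2/z^2 + 1) = 0.\<close>

lemma t_squared: "t\<^sup>2 = - z\<^sup>2"
proof -
  define h where "h = y / 2"
  \<comment> \<open>In this scaling the claim reads 4s^2 = -1.\<close>
  define s where "s = t / (2 * z)"
  have y: "y = 2 * h" and t: "t = 2 * z * s" using z_nz by (simp_all add: h_def s_def)
  have x: "x = h * z" and t0: "trace T = z\<^sup>2 * s"
    using two_x two_trace_T by (simp_all add: y t power2_eq_square)
  have t1: "trace (A ** T) = 2 * h * z * s"
    using trace_A_T by (simp add: y t)
  have "z * trace (B ** T) = z * (2 * h * (z\<^sup>2 - 2) * s)"
    using trace_B_T by (simp add: y t mult_ac)
  then have t2: "trace (B ** T) = 2 * h * (z\<^sup>2 - 2) * s"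
    using z_nz by (metis mult_cancel_left)
  have "2 * (z\<^sup>2 * (2 * h\<^sup>2 - 1)) = 2 * 4" using curve' by (simp add: y power_mult_distrib algebra_simps)
  then have c: "z\<^sup>2 * (2 * h\<^sup>2 - 1) = 4" by simp
  have "(l - 2) * (4 * s\<^sup>2 + 1) = 0"
    using fricke[OF det] c[THEN diff_eq_0I] unfolding t0 t1 t2 t x y by algebra
  then have "4 * s\<^sup>2 + 1 = 0" using l_ne_2 by simp
  then show ?thesis unfolding t by algebra
qed

end

text \<open>On the curve, l = 2 forces z^2 = y^2 = 4, so all three traces are 2 up to sign and
  \<open>commute_of_trace_2\<close> applies.\<close>

lemma l_eq_2_commute:
  assumes "y \<noteq> 0" and "l = 2"
  shows "A ** B = B ** A"
proof -
  have c: "z\<^sup>2 * (y\<^sup>2 - 2) = 8" using curve assms by blast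
  define h where "h = y / 2"
  have h: "y = 2 * h" by (simp add: h_def)
  have "x = h * z" using two_x by (simp add: h)
  then have "(h * z)\<^sup>2 + (2 * h)\<^sup>2 + z\<^sup>2 - (h * z) * (2 * h) * z - 2 - 2 = 0"
    using assms(2) by (simp add: h)
  moreover have "2 * (z\<^sup>2 * (2 * h\<^sup>2 - 1)) = 2 * 4" using c by (simp add: h power_mult_distrib algebra_simps)
  then have "z\<^sup>2 * (2 * h\<^sup>2 - 1) - 4 = 0" by simp
  ultimately have "(z\<^sup>2 - 4)\<^sup>2 = 0" by algebra
  then have z: "z\<^sup>2 = 4" by simp
  then have y: "y\<^sup>2 = 4" using c z by simp
  have "x = 2 * (y * z / 4)" using two_x by (simp add: field_simps)
  moreover have "z = 2 * (y * z / 4) * (y / 2)" using y by (simp add: power2_eq_square)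
  moreover have "(y * z / 4)\<^sup>2 = 1" "(y / 2)\<^sup>2 = 1" using y z by (simp_all add: power_divide power_mult_distrib)
  ultimately show ?thesis
    using commute_of_trace_2[of A B "y * z / 4" "y / 2"] by simp
qed

lemma A_fourth_power:
  assumes "y = 0"
  shows "A ** A ** A ** A = mat 1"
proof -
  have "x = 0" using two_x assms by simp
  then have "A ** A = comb A B (- 1) 0 0 0"
    using comb_mult_A_left[OF det(1), of B 0 1 0 0] by (simp flip: comb_basis)
  then have 1: "A ** A = - mat 1" by (simp add: vec_eq_iff forall_2 comb_nth) (simp add: mat_def)
  have "A ** A ** A ** A = (A ** A) ** (A ** A)" by (simp add: matrix_mul_assoc)
  then show ?thesis unfolding 1 by (simp add: mat2_simps)
qed

text \<open>Cayley-Hamilton gives A^4 = (1 - x^2) + (x^3 - 2x) A. The coefficient of A cannot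
  vanish, since then x^2 = 0; hence A is scalar.\<close>

lemma A_fourth_power_D:
  assumes "A ** A ** A ** A = mat 1" and "x \<noteq> 0"
  shows "A ** B = B ** A"
proof -
  have d: "A$1$1 * A$2$2 - A$1$2 * A$2$1 = 1" using det by (simp add: det_2)
  have AA: "A ** A = comb A B (- 1) x 0 0"
    using comb_mult_A_left[OF det(1), of B 0 1 0 0] by (simp flip: comb_basis)
  have "A ** A ** A ** A = A ** (A ** (A ** A))" by (simp add: matrix_mul_assoc)
  also have "\<dots> = comb A B (1 - x\<^sup>2) (x ^ 3 - 2 * x) 0 0"
    unfolding AA comb_mult_A_left[OF det(1)] by (intro comb_eqI) (simp_all add: algebra_simps power2_eq_square power3_eq_cube)
  finally have e: "comb A B (1 - x\<^sup>2) (x ^ 3 - 2 * x) 0 0 = mat 1" using assms by simp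
  have "x ^ 3 - 2 * x \<noteq> 0"
  proof
    assume 0: "x ^ 3 - 2 * x = 0"
    with e have "comb A B (1 - x\<^sup>2) 0 0 0 = mat 1" by simp
    then have "x\<^sup>2 = 0" by (simp add: vec_eq_iff forall_2 comb_nth) (simp add: mat_def)
    then show False using assms by simp
  qed
  moreover have "(x ^ 3 - 2 * x) * A$1$2 = 0" "(x ^ 3 - 2 * x) * A$2$1 = 0"
    "(x ^ 3 - 2 * x) * (A$1$1 - A$2$2) = 0"
    using e by (simp_all add: vec_eq_iff forall_2 comb_nth) (simp_all add: mat_def, algebra+)
  ultimately have "A$1$2 = 0" "A$2$1 = 0" "A$1$1 = A$2$2" by simp_all
  then show ?thesis by (simp add: mat2_simps)
qed

lemma commute_l_eq_2:
  assumes "A ** B = B ** A"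
  shows "l = 2"
proof -
  obtain A' B' where inv: "A ** A' = mat 1" "B ** B' = mat 1"
    using det invertible_det_nz unfolding invertible_def by (metis zero_neq_one)
  have "A ** B ** A' ** B' = mat 1"
    using assms inv by (metis matrix_mul_assoc matrix_mul_rid)
  then show ?thesis
    using trace_commutator[OF det(1,2) inv] by (simp add: trace_I)
qed

end

section \<open>Construction of representations\<close>

lemma comb_eqI_diff:
  "p - p' = 0 \<Longrightarrow> q - q' = 0 \<Longrightarrow> r - r' = 0 \<Longrightarrow> s - s' = 0 \<Longrightarrow> comb A B p q r s = comb A B p' q' r' s'"
  by simp

lemma mat_mult_commute: "A ** mat k = mat k ** (A :: complex^2^2)"
  by (simp add: mat2_simps)

lemma det_mat_mult: "det (mat k ** A) = k\<^sup>2 * det (A :: complex^2^2)"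
  by (simp add: mat2_simps) algebra

text \<open>The relations are linear in T, so a nonsingular solution can be rescaled to determinant
  1. On the curve the determinant of the solution below vanishes only at the excluded value z^2 =
  4.\<close>

lemma bundle_triple_over_pair_exists:
  fixes A B :: "complex^2^2" and h z :: complex
  assumes det: "det A = 1" "det B = 1" and tr: "trace A = h * z" "trace B = 2 * h" "trace (A ** B) = z"
    and c: "z\<^sup>2 * (2 * h\<^sup>2 - 1) = 4" and z: "z\<^sup>2 \<noteq> 4"
  shows "\<exists>T. bundle_triple A B T"
proof -
  let ?c = "comb A B"
  \<comment> \<open>Up to a factor, \<open>K\<close> is the only solution of the linear equations \<open>BABKA = K\<close> and \<open>KB = BAKAAA\<close>
    in the span of \<open>1, A, B, AB\<close>.\<close>
  define K where "K = ?c (z ^ 4 - 6 * z\<^sup>2 - 8) (2 * h * z ^ 3) (4 * h * z\<^sup>2) (- 2 * z ^ 3)"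
  note c0 = c[THEN diff_eq_0I]
  note A_left = comb_mult_A_left[OF det(1), of B, unfolded tr]
    and B_left = comb_mult_B_left[OF det, unfolded tr]
    and A_right = comb_mult_A_right[OF det, unfolded tr]
    and B_right = comb_mult_B_right[OF det(2), of A, unfolded tr]
  \<comment> \<open>The products BABKA and BAKAAA are built one factor at a time, and each
    coordinate is reduced by the curve equation \<open>c0\<close>.\<close>
  have KA: "K ** A = ?c (2 * h * z ^ 3 - 16 * h * z) (2 * z\<^sup>2 + 8) (8 * z) (- 4 * h * z\<^sup>2)"
    unfolding K_def A_right using c0 by (intro comb_eqI_diff; (algebra | simp add: algebra_simps eval_nat_numeral))
  have 1: "B ** (K ** A) = ?c (2 * z ^ 3 - 16 * h\<^sup>2 * z) (16 * h) (8 * h * z) (- 2 * z\<^sup>2 - 8)"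
    unfolding KA B_left using c0 by (intro comb_eqI_diff; (algebra | simp add: algebra_simps eval_nat_numeral))
  have 2: "A ** (B ** (K ** A)) = ?c (- 16 * h) (2 * z ^ 3) (2 * z\<^sup>2 + 8) (- 2 * h * z ^ 3)"
    unfolding 1 A_left using c0 by (intro comb_eqI_diff; (algebra | simp add: algebra_simps eval_nat_numeral))
  have 3: "B ** (A ** (B ** (K ** A))) = K"
    unfolding 2 B_left unfolding K_def using c0 by (intro comb_eqI_diff; (algebra | simp add: algebra_simps eval_nat_numeral))
  have KAA: "K ** A ** A = ?c (2 * z\<^sup>2 - 24) (8 * h * z) (4 * h * z\<^sup>2) (- 8 * z)"
    unfolding KA A_right using c0 by (intro comb_eqI_diff; (algebra | simp add: algebra_simps eval_nat_numeral))
  have KAAA: "K ** A ** A ** A = ?c (- 8 * h * z) (2 * z\<^sup>2 + 8) (2 * z ^ 3) (- 4 * h * z\<^sup>2)"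
    unfolding KAA A_right using c0 by (intro comb_eqI_diff; (algebra | simp add: algebra_simps eval_nat_numeral))
  have 4: "A ** (K ** A ** A ** A) = ?c (- 2 * z\<^sup>2 - 8) (2 * h * z ^ 3) (4 * h * z\<^sup>2) (- 8 * z)"
    unfolding KAAA A_left using c0 by (intro comb_eqI_diff; (algebra | simp add: algebra_simps eval_nat_numeral))
  have 5: "B ** (A ** (K ** A ** A ** A)) = K ** B"
    unfolding 4 B_left unfolding K_def B_right using c0 by (intro comb_eqI_diff; (algebra | simp add: algebra_simps eval_nat_numeral))
  have detK: "det K = - 4 * (z\<^sup>2 - 4)\<^sup>2"
    unfolding K_def det_comb[OF det] tr using c0 by algebra
  \<comment> \<open>Chosen as a root of k^2 det(K) = 1.\<close>
  define k where "k = \<i> / (2 * (z\<^sup>2 - 4))"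
  have "2 * (z\<^sup>2 - 4) * k = \<i>"
    using z by (simp add: k_def)
  then have "(2 * (z\<^sup>2 - 4) * k)\<^sup>2 + 1 = 0" by simp
  then have k: "k\<^sup>2 * (- 4 * (z\<^sup>2 - 4)\<^sup>2) = 1"
    by algebra
  define T where "T = mat k ** K"
  have pull: "N ** (mat k ** L) = mat k ** (N ** L)" for N L :: "complex^2^2"
    by (simp only: matrix_mul_assoc mat_mult_commute[of N])
  show ?thesis
  proof (rule exI, unfold_locales)
    show "det T = 1" using k by (simp add: T_def det_mat_mult detK)
    show "B ** A ** B ** T ** A = T"
    proof -
      have "B ** A ** B ** T ** A = B ** (A ** (B ** (mat k ** (K ** A))))"
        unfolding T_def by (simp only: matrix_mul_assoc)
      also have "\<dots> = T" unfolding pull 3 T_def ..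
      finally show ?thesis .
    qed
    show "T ** B = B ** A ** T ** A ** A ** A"
    proof -
      have "B ** A ** T ** A ** A ** A = B ** (A ** (mat k ** (K ** A ** A ** A)))"
        unfolding T_def by (simp only: matrix_mul_assoc)
      also have "\<dots> = mat k ** (K ** B)" unfolding pull 5 ..
      also have "\<dots> = T ** B" unfolding T_def by (simp only: matrix_mul_assoc)
      finally show ?thesis by simp
    qed
  qed (use det in auto)
qed

lemma SL2_pair_exists:
  obtains A B :: "complex^2^2"
  where "det A = 1" "det B = 1" "trace A = x" "trace B = y" "trace (A ** B) = z"
proof -
  \<comment> \<open>The roots u, v of X^2 - zX + 1: then det(B) = uv = 1, and AB is upper triangular
    with diagonal v, u.\<close>
  define u where "u = (z + csqrt (z\<^sup>2 - 4)) / 2"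
  define v where "v = (z - csqrt (z\<^sup>2 - 4)) / 2"
  have "csqrt (z\<^sup>2 - 4) * csqrt (z\<^sup>2 - 4) = z\<^sup>2 - 4"
    by (metis power2_csqrt power2_eq_square)
  then have uv: "u * v = 1" "u + v = z"
    by (simp_all add: u_def v_def field_simps power2_eq_square)
  define A :: "complex^2^2" where "A = vector [vector [x, - 1], vector [1, 0]]"
  define B :: "complex^2^2" where "B = vector [vector [0, u], vector [- v, y]]"
  show thesis
    by (rule that[of A B]) (use uv in \<open>simp_all add: A_def B_def mat2_simps algebra_simps\<close>)
qed

lemma bundle_triple_exists:
  fixes y z \<eta> :: complex
  assumes c: "z\<^sup>2 * (y\<^sup>2 - 2) = 8" and y: "y \<noteq> 0" and z: "z\<^sup>2 \<noteq> 4" and "\<eta>\<^sup>2 = - 1"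
  obtains A B T where "bundle_triple A B T" "2 * trace A = y * z" "trace B = y" "trace (A ** B) = z"
    "trace (A ** B ** T) = \<eta> * z" "(trace A)\<^sup>2 + y\<^sup>2 + z\<^sup>2 - trace A * y * z - 2 \<noteq> 2"
proof -
  define h where "h = y / 2"
  have h: "y = 2 * h" by (simp add: h_def)
  have "2 * (z\<^sup>2 * (2 * h\<^sup>2 - 1)) = 2 * 4"
    using c by (simp add: h power_mult_distrib algebra_simps)
  then have c': "z\<^sup>2 * (2 * h\<^sup>2 - 1) = 4" by simp
  obtain A B :: "complex^2^2" where AB: "det A = 1" "det B = 1" "trace A = h * z" "trace B = 2 * h" "trace (A ** B) = z"
    using SL2_pair_exists .
  obtain T where "bundle_triple A B T"
    using bundle_triple_over_pair_exists[OF AB c' z] by blast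
  then interpret bundle_triple A B T .
  have l: "(h * z)\<^sup>2 + (2 * h)\<^sup>2 + z\<^sup>2 - h * z * (2 * h) * z - 2 \<noteq> 2"
  proof
    assume "(h * z)\<^sup>2 + (2 * h)\<^sup>2 + z\<^sup>2 - h * z * (2 * h) * z - 2 = 2"
    then have "(h * z)\<^sup>2 + (2 * h)\<^sup>2 + z\<^sup>2 - h * z * (2 * h) * z - 2 - 2 = 0" by simp
    with c'[THEN diff_eq_0I] have "(z\<^sup>2 - 4)\<^sup>2 = 0" by algebra
    with z show False by simp
  qed
  then have "(trace (A ** B ** T))\<^sup>2 = - z\<^sup>2"
    using t_squared y AB by (simp add: h)
  then have "(trace (A ** B ** T))\<^sup>2 = (\<eta> * z)\<^sup>2"
    using assms(4) by (simp add: power_mult_distrib)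
  then consider "trace (A ** B ** T) = \<eta> * z" | "trace (A ** B ** T) = - (\<eta> * z)"
    using power2_eq_iff by blast
  then show thesis
  proof cases
    case 1
    then show ?thesis using that[of A B T] bundle_triple_axioms AB l by (simp add: h)
  next
    \<comment> \<open>Both relations survive the change from T to -T, which reverses the sign of
      tr(ABT).\<close>
    case 2
    have neg: "N ** (- L) = - (N ** L)" "(- L) ** N = - (L ** N)" for N L :: "complex^2^2"
      by (simp_all add: mat2_simps)
    have "bundle_triple A B (- T)"
    proof
      show "det (- T) = 1" using det(3) by (simp add: det_2)
      show "B ** A ** B ** - T ** A = - T" by (simp add: neg rel_A)
      show "- T ** B = B ** A ** - T ** A ** A ** A" by (simp add: neg flip: rel_B)
    qed (use AB in auto)
    moreover have "trace (A ** B ** (- T)) = \<eta> * z"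
      using 2 by (simp add: neg trace_def sum_negf)
    ultimately show ?thesis using that[of A B "- T"] AB l by (simp add: h)
  qed
qed

section \<open>Regular functions on the generic characters\<close>

text \<open>The outer variable of P stands for y and the inner one for z; y is substituted as a
  constant polynomial.\<close>

definition eval2 :: "complex poly poly \<Rightarrow> complex \<Rightarrow> complex \<Rightarrow> complex" where
  "eval2 P y z = poly (poly P [:y:]) z"

lemma eval2_simps [simp]:
  "eval2 (P + Q) y z = eval2 P y z + eval2 Q y z"
  "eval2 (P * Q) y z = eval2 P y z * eval2 Q y z"
  "eval2 [:[:c:]:] y z = c"
  "eval2 [:0, 1:] y z = y"
  "eval2 [:[:0, 1:]:] y z = z"
  by (simp_all add: eval2_def)

abbreviation (input) "mat_a \<rho> \<equiv> \<rho> (piN_gen Alpha)"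
abbreviation (input) "mat_b \<rho> \<equiv> \<rho> (piN_gen Beta)"
abbreviation (input) "mat_t \<rho> \<equiv> \<rho> (piN_gen Tau)"
abbreviation (input) "y_of \<rho> \<equiv> trace (mat_b \<rho> :: complex^2^2)"
abbreviation (input) "z_of \<rho> \<equiv> trace (mat_a \<rho> ** mat_b \<rho> :: complex^2^2)"
abbreviation (input) "l_of \<rho> \<equiv> (trace (mat_a \<rho>))\<^sup>2 + (y_of \<rho>)\<^sup>2 + (z_of \<rho>)\<^sup>2 - trace (mat_a \<rho>) * y_of \<rho> * z_of \<rho> - 2"

lemma representations_mult:
  assumes "\<rho> \<in> representations piN" "X \<in> carrier piN" "Y \<in> carrier piN"
  shows "\<rho> (X \<otimes>\<^bsub>piN\<^esub> Y) = \<rho> X ** \<rho> Y"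
  using assms by (simp add: representations_def hom_mult SL2_def)

lemma representations_det:
  assumes "\<rho> \<in> representations piN" "X \<in> carrier piN"
  shows "det (\<rho> X) = 1"
  using hom_in_carrier[of \<rho> piN SL2 X] assms by (simp add: representations_def SL2_def)

lemma representations_one:
  assumes "\<rho> \<in> representations piN"
  shows "\<rho> \<one>\<^bsub>piN\<^esub> = mat 1"
  using hom_one[of \<rho> piN SL2] assms group_SL2 piN.group_axioms
  by (simp add: representations_def SL2_def)

lemma representations_inv:
  assumes "\<rho> \<in> representations piN" "X \<in> carrier piN"
  shows "\<rho> X ** \<rho> (inv\<^bsub>piN\<^esub> X) = mat 1"
  using representations_mult[OF assms(1), of X "inv\<^bsub>piN\<^esub> X"] representations_one[OF assms(1)] assms(2)
  by simp

lemma representations_bundle_triple: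
  assumes "\<rho> \<in> representations piN"
  shows "bundle_triple (mat_a \<rho>) (mat_b \<rho>) (mat_t \<rho>)"
proof
  note simps = representations_mult[OF assms]
  show "mat_b \<rho> ** mat_a \<rho> ** mat_b \<rho> ** mat_t \<rho> ** mat_a \<rho> = mat_t \<rho>"
    using arg_cong[OF piN_gen_relations(1), of \<rho>] by (simp add: simps)
  show "mat_t \<rho> ** mat_b \<rho> = mat_b \<rho> ** mat_a \<rho> ** mat_t \<rho> ** mat_a \<rho> ** mat_a \<rho> ** mat_a \<rho>"
    using arg_cong[OF piN_gen_relations(2), of \<rho>] by (simp add: simps)
qed (simp_all add: representations_det assms)

lemma bundle_triple_representation:
  assumes "bundle_triple A B T"
  obtains \<rho> where "\<rho> \<in> representations piN" "mat_a \<rho> = A" "mat_b \<rho> = B" "mat_t \<rho> = T"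
proof -
  interpret bundle_triple A B T by fact
  interpret SL2: group SL2 by (rule group_SL2)
  show thesis
    using SL2.piN_hom_exists[of A B T] that rel_A rel_B by (auto simp: SL2_def representations_def)
qed

lemma l_of_commutator:
  assumes "\<rho> \<in> representations piN"
  shows "trace (\<rho> (commutator piN (piN_gen Alpha) (piN_gen Beta))) = l_of \<rho>"
  using trace_commutator[of "mat_a \<rho>" "mat_b \<rho>"] assms
  by (simp add: commutator_def representations_mult representations_det representations_inv)

text \<open>The generic representations. By \<open>t_squared\<close> every representation with y
  nonzero and l different from 2 occurs for \<eta> = \<i> or for \<eta> = -\<i>.\<close>

definition good_reps :: "complex \<Rightarrow> (generator word set \<Rightarrow> complex^2^2) set" where
  "good_reps \<eta> = {\<rho> \<in> representations piN. y_of \<rho> \<noteq> 0 \<and> l_of \<rho> \<noteq> 2 \<and>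
     trace (mat_a \<rho> ** mat_b \<rho> ** mat_t \<rho>) = \<eta> * z_of \<rho>}"

lemma good_reps_cases:
  assumes "\<rho> \<in> representations piN" "y_of \<rho> \<noteq> 0" "l_of \<rho> \<noteq> 2"
  shows "\<rho> \<in> good_reps \<i> \<or> \<rho> \<in> good_reps (- \<i>)"
proof -
  interpret bundle_triple "mat_a \<rho>" "mat_b \<rho>" "mat_t \<rho>"
    by (rule representations_bundle_triple) fact
  have "t\<^sup>2 = (\<i> * z)\<^sup>2"
    using t_squared assms by (simp add: power_mult_distrib)
  then show ?thesis
    using assms power2_eq_iff[of t "\<i> * z"] by (auto simp: good_reps_def)
qed

text \<open>Substituting x = yz/2 and using the curve equation makes l a polynomial in y^2 and z^2.
  In particular z^2 = 4 would give y^2 = 4 and l = 2.\<close>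

lemma good_reps_curve:
  assumes "\<rho> \<in> good_reps \<eta>"
  shows "(z_of \<rho>)\<^sup>2 * ((y_of \<rho>)\<^sup>2 - 2) = 8" "2 * trace (mat_a \<rho>) = y_of \<rho> * z_of \<rho>" "y_of \<rho> \<noteq> 0"
    "2 * l_of \<rho> = 2 * (y_of \<rho>)\<^sup>2 + (z_of \<rho>)\<^sup>2 - 8" "(z_of \<rho>)\<^sup>2 \<noteq> 4" "z_of \<rho> \<noteq> 0"
proof -
  interpret bundle_triple "mat_a \<rho>" "mat_b \<rho>" "mat_t \<rho>"
    using assms by (intro representations_bundle_triple) (simp add: good_reps_def)
  have yl: "y \<noteq> 0" "l \<noteq> 2" using assms by (auto simp: good_reps_def)
  note c = curve'[OF yl]
  define h where "h = y / 2"
  have y: "y = 2 * h" by (simp add: h_def)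
  have x: "x = h * z" using two_x by (simp add: y)
  have "2 * (z\<^sup>2 * (2 * h\<^sup>2 - 1)) = 2 * 4" using c by (simp add: y power_mult_distrib algebra_simps)
  then have c': "z\<^sup>2 * (2 * h\<^sup>2 - 1) - 4 = 0" by (simp add: mult.commute)
  show "z\<^sup>2 * (y\<^sup>2 - 2) = 8" "2 * x = y * z" "y \<noteq> 0" "z \<noteq> 0" using c two_x yl z_nz by auto
  have "2 * l - (2 * y\<^sup>2 + z\<^sup>2 - 8) = 0" unfolding x unfolding y using c' by algebra
  then show l: "2 * l = 2 * y\<^sup>2 + z\<^sup>2 - 8" by (simp only: right_minus_eq)
  show "z\<^sup>2 \<noteq> 4"
  proof
    assume "z\<^sup>2 = 4"
    with c have "y\<^sup>2 = 4" by simp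
    note l
    also have "2 * y\<^sup>2 + z\<^sup>2 - 8 = 2 * 2" using \<open>z\<^sup>2 = 4\<close> \<open>y\<^sup>2 = 4\<close> by simp
    finally have "2 * l = 2 * 2" .
    then have "l = 2" by (simp only: mult_cancel_left) simp
    with yl show False by simp
  qed
qed

lemma good_reps_traces:
  assumes "\<rho> \<in> good_reps \<eta>"
  shows "trace (mat_t \<rho>) = \<eta> / 2 * z_of \<rho> * z_of \<rho>"
    and "trace (mat_a \<rho> ** mat_t \<rho>) = \<eta> / 2 * y_of \<rho> * z_of \<rho>"
    and "trace (mat_b \<rho> ** mat_t \<rho>) = \<eta> / 2 * (z_of \<rho> * z_of \<rho> - 2) * y_of \<rho>"
    and "trace (mat_a \<rho> ** mat_b \<rho> ** mat_t \<rho>) = \<eta> * z_of \<rho>"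
proof -
  interpret bundle_triple "mat_a \<rho>" "mat_b \<rho>" "mat_t \<rho>"
    using assms by (intro representations_bundle_triple) (simp add: good_reps_def)
  have yl: "y \<noteq> 0" "l \<noteq> 2" using assms by (auto simp: good_reps_def)
  show t: "t = \<eta> * z" using assms by (auto simp: good_reps_def)
  show "trace (mat_t \<rho>) = \<eta> / 2 * z * z"
    using two_trace_T by (simp add: t field_simps)
  show "trace (mat_a \<rho> ** mat_t \<rho>) = \<eta> / 2 * y * z"
    using trace_A_T[OF yl] by (simp add: t field_simps)
  have "z * (2 * trace (mat_b \<rho> ** mat_t \<rho>)) = z * (\<eta> * (z * z - 2) * y)"
    using trace_B_T[OF yl] by (simp add: t power2_eq_square mult_ac)
  then have "2 * trace (mat_b \<rho> ** mat_t \<rho>) = \<eta> * (z * z - 2) * y"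
    using z_nz[OF yl] by (metis mult_cancel_left)
  then show "trace (mat_b \<rho> ** mat_t \<rho>) = \<eta> / 2 * (z * z - 2) * y"
    by (simp add: field_simps)
qed

lemma good_reps_exist:
  assumes "z\<^sup>2 * (y\<^sup>2 - 2) = 8" "y \<noteq> 0" "z\<^sup>2 \<noteq> 4" "\<eta>\<^sup>2 = - 1"
  obtains \<rho> where "\<rho> \<in> good_reps \<eta>" "y_of \<rho> = y" "z_of \<rho> = z"
proof -
  obtain A B T where *: "bundle_triple A B T" "2 * trace A = y * z" "trace B = y" "trace (A ** B) = z"
    "trace (A ** B ** T) = \<eta> * z" "(trace A)\<^sup>2 + y\<^sup>2 + z\<^sup>2 - trace A * y * z - 2 \<noteq> 2"
    using bundle_triple_exists[OF assms] .
  obtain \<rho> where "\<rho> \<in> representations piN" "mat_a \<rho> = A" "mat_b \<rho> = B" "mat_t \<rho> = T"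
    using bundle_triple_representation[OF *(1)] .
  with * assms(2) show thesis
    using that[of \<rho>] by (simp add: good_reps_def)
qed

section \<open>Functions that are polynomial in \<open>y\<close> and \<open>z\<close>\<close>

definition regular_on_good :: "complex \<Rightarrow> ((generator word set \<Rightarrow> complex^2^2) \<Rightarrow> complex) \<Rightarrow> bool" where
  "regular_on_good \<eta> f \<longleftrightarrow> (\<exists>P. \<forall>\<rho>\<in>good_reps \<eta>. f \<rho> = eval2 P (y_of \<rho>) (z_of \<rho>))"

lemma regular_const: "regular_on_good \<eta> (\<lambda>\<rho>. c)"
  unfolding regular_on_good_def by (rule exI[of _ "[:[:c:]:]"]) simp

lemma regular_y: "regular_on_good \<eta> (\<lambda>\<rho>. y_of \<rho>)"
  unfolding regular_on_good_def by (rule exI[of _ "[:0, 1:]"]) simp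

lemma regular_z: "regular_on_good \<eta> (\<lambda>\<rho>. z_of \<rho>)"
  unfolding regular_on_good_def by (rule exI[of _ "[:[:0, 1:]:]"]) simp

lemma regular_add:
  assumes "regular_on_good \<eta> f" "regular_on_good \<eta> g"
  shows "regular_on_good \<eta> (\<lambda>\<rho>. f \<rho> + g \<rho>)"
proof -
  obtain P Q where "\<forall>\<rho>\<in>good_reps \<eta>. f \<rho> = eval2 P (y_of \<rho>) (z_of \<rho>)"
    "\<forall>\<rho>\<in>good_reps \<eta>. g \<rho> = eval2 Q (y_of \<rho>) (z_of \<rho>)"
    using assms unfolding regular_on_good_def by blast
  then show ?thesis unfolding regular_on_good_def by (intro exI[of _ "P + Q"]) simp
qed

lemma regular_mult:
  assumes "regular_on_good \<eta> f" "regular_on_good \<eta> g"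
  shows "regular_on_good \<eta> (\<lambda>\<rho>. f \<rho> * g \<rho>)"
proof -
  obtain P Q where "\<forall>\<rho>\<in>good_reps \<eta>. f \<rho> = eval2 P (y_of \<rho>) (z_of \<rho>)"
    "\<forall>\<rho>\<in>good_reps \<eta>. g \<rho> = eval2 Q (y_of \<rho>) (z_of \<rho>)"
    using assms unfolding regular_on_good_def by blast
  then show ?thesis unfolding regular_on_good_def by (intro exI[of _ "P * Q"]) simp
qed

lemma regular_uminus: "regular_on_good \<eta> f \<Longrightarrow> regular_on_good \<eta> (\<lambda>\<rho>. - f \<rho>)"
  using regular_mult[OF regular_const[of _ "- 1"], of _ f] by simp

lemma regular_diff:
  "regular_on_good \<eta> f \<Longrightarrow> regular_on_good \<eta> g \<Longrightarrow> regular_on_good \<eta> (\<lambda>\<rho>. f \<rho> - g \<rho>)"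
  using regular_add[OF _ regular_uminus, of _ f g] by simp

lemma regular_cong:
  assumes "regular_on_good \<eta> f" "\<And>\<rho>. \<rho> \<in> good_reps \<eta> \<Longrightarrow> g \<rho> = f \<rho>"
  shows "regular_on_good \<eta> g"
  using assms unfolding regular_on_good_def by metis

lemmas regular_intros = regular_const regular_y regular_z regular_add regular_mult regular_uminus regular_diff

lemma regular_x: "regular_on_good \<eta> (\<lambda>\<rho>. trace (mat_a \<rho>))"
proof (rule regular_cong[of _ "\<lambda>\<rho>. 1 / 2 * (y_of \<rho> * z_of \<rho>)"])
  show "trace (mat_a \<rho>) = 1 / 2 * (y_of \<rho> * z_of \<rho>)" if "\<rho> \<in> good_reps \<eta>" for \<rho>
    unfolding good_reps_curve(2)[OF that, symmetric] by simp
qed (intro regular_intros)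

section \<open>Matrix functions with coordinates polynomial in \<open>y\<close> and
  \<open>z\<close>\<close>

lemma good_reps_bundle_triple:
  "\<rho> \<in> good_reps \<eta> \<Longrightarrow> bundle_triple (mat_a \<rho>) (mat_b \<rho>) (mat_t \<rho>)"
  by (simp add: good_reps_def representations_bundle_triple)

lemma good_reps_det:
  assumes "\<rho> \<in> good_reps \<eta>"
  shows "det (\<rho> (piN_gen g)) = 1"
  using assms by (simp add: good_reps_def representations_det)

lemma comb_add: "comb A B p q r s + comb A B p' q' r' s' = comb A B (p + p') (q + q') (r + r') (s + s')"
  by (simp add: vec_eq_iff forall_2 comb_nth algebra_simps)

lemma mat_mult_comb: "mat c ** comb A B p q r s = comb A B (c * p) (c * q) (c * r) (c * s)"
  by (simp add: vec_eq_iff forall_2 comb_nth) (simp add: mat2_simps comb_nth algebra_simps)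

lemma matrix_mult_add:
  fixes M N L :: "complex^2^2"
  shows "M ** (N + L) = M ** N + M ** L" "(N + L) ** M = N ** M + L ** M"
  by (simp_all add: mat2_simps algebra_simps)

text \<open>The algebra spanned by 1, A, B, AB over the polynomials in y and z. It contains the
  images of the fibre group generated by \<alpha> and \<beta>.\<close>

definition fiber_order :: "complex \<Rightarrow> ((generator word set \<Rightarrow> complex^2^2) \<Rightarrow> complex^2^2) \<Rightarrow> bool" where
  "fiber_order \<eta> F \<longleftrightarrow> (\<exists>p q r s. regular_on_good \<eta> p \<and> regular_on_good \<eta> q \<and> regular_on_good \<eta> r \<and> regular_on_good \<eta> s \<and>
     (\<forall>\<rho>\<in>good_reps \<eta>. F \<rho> = comb (mat_a \<rho>) (mat_b \<rho>) (p \<rho>) (q \<rho>) (r \<rho>) (s \<rho>)))"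

lemma fiber_orderI:
  assumes "\<And>\<rho>. \<rho> \<in> good_reps \<eta> \<Longrightarrow> F \<rho> = comb (mat_a \<rho>) (mat_b \<rho>) (p \<rho>) (q \<rho>) (r \<rho>) (s \<rho>)"
    and "regular_on_good \<eta> p" "regular_on_good \<eta> q" "regular_on_good \<eta> r" "regular_on_good \<eta> s"
  shows "fiber_order \<eta> F"
  using assms unfolding fiber_order_def by blast

lemma fiber_orderE:
  assumes "fiber_order \<eta> F"
  obtains p q r s where
    "regular_on_good \<eta> p" "regular_on_good \<eta> q" "regular_on_good \<eta> r" "regular_on_good \<eta> s"
    "\<And>\<rho>. \<rho> \<in> good_reps \<eta> \<Longrightarrow> F \<rho> = comb (mat_a \<rho>) (mat_b \<rho>) (p \<rho>) (q \<rho>) (r \<rho>) (s \<rho>)"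
  using assms unfolding fiber_order_def by blast

lemma fiber_order_const: "fiber_order \<eta> (\<lambda>\<rho>. mat c)"
proof (rule fiber_orderI)
  show "mat c = comb A B c 0 0 0" for A B
    by (simp add: vec_eq_iff forall_2 comb_nth) (simp add: mat_def)
qed (rule regular_const)+

lemma fiber_order_add:
  assumes "fiber_order \<eta> F" "fiber_order \<eta> G"
  shows "fiber_order \<eta> (\<lambda>\<rho>. F \<rho> + G \<rho>)"
proof -
  obtain p q r s where F:
    "regular_on_good \<eta> p" "regular_on_good \<eta> q" "regular_on_good \<eta> r" "regular_on_good \<eta> s"
    "\<And>\<rho>. \<rho> \<in> good_reps \<eta> \<Longrightarrow> F \<rho> = comb (mat_a \<rho>) (mat_b \<rho>) (p \<rho>) (q \<rho>) (r \<rho>) (s \<rho>)"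
    using fiber_orderE[OF assms(1)] by blast
  obtain p' q' r' s' where G:
    "regular_on_good \<eta> p'" "regular_on_good \<eta> q'" "regular_on_good \<eta> r'" "regular_on_good \<eta> s'"
    "\<And>\<rho>. \<rho> \<in> good_reps \<eta> \<Longrightarrow> G \<rho> = comb (mat_a \<rho>) (mat_b \<rho>) (p' \<rho>) (q' \<rho>) (r' \<rho>) (s' \<rho>)"
    using fiber_orderE[OF assms(2)] by blast
  from F G show ?thesis
    by (intro fiber_orderI[of _ _ "\<lambda>\<rho>. p \<rho> + p' \<rho>" "\<lambda>\<rho>. q \<rho> + q' \<rho>" "\<lambda>\<rho>. r \<rho> + r' \<rho>" "\<lambda>\<rho>. s \<rho> + s' \<rho>"])
      (simp_all add: regular_add comb_add)
qed

lemma fiber_order_scale: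
  assumes "regular_on_good \<eta> f" "fiber_order \<eta> F"
  shows "fiber_order \<eta> (\<lambda>\<rho>. mat (f \<rho>) ** F \<rho>)"
proof -
  obtain p q r s where F:
    "regular_on_good \<eta> p" "regular_on_good \<eta> q" "regular_on_good \<eta> r" "regular_on_good \<eta> s"
    "\<And>\<rho>. \<rho> \<in> good_reps \<eta> \<Longrightarrow> F \<rho> = comb (mat_a \<rho>) (mat_b \<rho>) (p \<rho>) (q \<rho>) (r \<rho>) (s \<rho>)"
    using fiber_orderE[OF assms(2)] by blast
  with assms(1) show ?thesis
    by (intro fiber_orderI[of _ _ "\<lambda>\<rho>. f \<rho> * p \<rho>" "\<lambda>\<rho>. f \<rho> * q \<rho>" "\<lambda>\<rho>. f \<rho> * r \<rho>" "\<lambda>\<rho>. f \<rho> * s \<rho>"])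
      (simp_all add: regular_mult mat_mult_comb)
qed

lemma fiber_order_mult_a:
  assumes "fiber_order \<eta> F"
  shows "fiber_order \<eta> (\<lambda>\<rho>. mat_a \<rho> ** F \<rho>)"
proof -
  obtain p q r s where F:
    "regular_on_good \<eta> p" "regular_on_good \<eta> q" "regular_on_good \<eta> r" "regular_on_good \<eta> s"
    "\<And>\<rho>. \<rho> \<in> good_reps \<eta> \<Longrightarrow> F \<rho> = comb (mat_a \<rho>) (mat_b \<rho>) (p \<rho>) (q \<rho>) (r \<rho>) (s \<rho>)"
    using fiber_orderE[OF assms] by blast
  show ?thesis
  proof (rule fiber_orderI)
    show "mat_a \<rho> ** F \<rho> = comb (mat_a \<rho>) (mat_b \<rho>) (- q \<rho>) (p \<rho> + trace (mat_a \<rho>) * q \<rho>)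
        (- s \<rho>) (r \<rho> + trace (mat_a \<rho>) * s \<rho>)" if "\<rho> \<in> good_reps \<eta>" for \<rho>
      using F(5) that comb_mult_A_left[OF good_reps_det[OF that]] by simp
  qed (intro regular_intros regular_x F)+
qed

lemma fiber_order_mult_b:
  assumes "fiber_order \<eta> F"
  shows "fiber_order \<eta> (\<lambda>\<rho>. mat_b \<rho> ** F \<rho>)"
proof -
  obtain p q r s where F:
    "regular_on_good \<eta> p" "regular_on_good \<eta> q" "regular_on_good \<eta> r" "regular_on_good \<eta> s"
    "\<And>\<rho>. \<rho> \<in> good_reps \<eta> \<Longrightarrow> F \<rho> = comb (mat_a \<rho>) (mat_b \<rho>) (p \<rho>) (q \<rho>) (r \<rho>) (s \<rho>)"
    using fiber_orderE[OF assms] by blast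
  show ?thesis
  proof (rule fiber_orderI)
    show "mat_b \<rho> ** F \<rho> = comb (mat_a \<rho>) (mat_b \<rho>)
        (q \<rho> * (z_of \<rho> - trace (mat_a \<rho>) * y_of \<rho>) - r \<rho> - trace (mat_a \<rho>) * s \<rho>)
        (y_of \<rho> * q \<rho> + s \<rho>)
        (p \<rho> + trace (mat_a \<rho>) * q \<rho> + y_of \<rho> * r \<rho> + z_of \<rho> * s \<rho>) (- q \<rho>)"
      if "\<rho> \<in> good_reps \<eta>" for \<rho>
      using F(5) that comb_mult_B_left[OF good_reps_det[OF that] good_reps_det[OF that]] by simp
  qed (intro regular_intros regular_x F)+
qed

text \<open>Adjoins T to the previous algebra. The first power suffices, since T can be moved to the
  right past A and B and T^2 = tr(T) T - 1.\<close>

definition full_order :: "complex \<Rightarrow> ((generator word set \<Rightarrow> complex^2^2) \<Rightarrow> complex^2^2) \<Rightarrow> bool" where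
  "full_order \<eta> F \<longleftrightarrow> (\<exists>G H. fiber_order \<eta> G \<and> fiber_order \<eta> H \<and>
     (\<forall>\<rho>\<in>good_reps \<eta>. F \<rho> = G \<rho> + H \<rho> ** mat_t \<rho>))"

lemma full_orderI:
  assumes "\<And>\<rho>. \<rho> \<in> good_reps \<eta> \<Longrightarrow> F \<rho> = G \<rho> + H \<rho> ** mat_t \<rho>" "fiber_order \<eta> G" "fiber_order \<eta> H"
  shows "full_order \<eta> F"
  using assms unfolding full_order_def by blast

lemma full_orderE:
  assumes "full_order \<eta> F"
  obtains G H where "fiber_order \<eta> G" "fiber_order \<eta> H"
    "\<And>\<rho>. \<rho> \<in> good_reps \<eta> \<Longrightarrow> F \<rho> = G \<rho> + H \<rho> ** mat_t \<rho>"
  using assms unfolding full_order_def by blast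

lemma full_order_cong:
  assumes "full_order \<eta> F" "\<And>\<rho>. \<rho> \<in> good_reps \<eta> \<Longrightarrow> G \<rho> = F \<rho>"
  shows "full_order \<eta> G"
  using assms unfolding full_order_def by metis

lemma mat_0: "mat 0 = (0 :: complex^2^2)"
  by (simp add: mat_def vec_eq_iff)

lemma full_order_const: "full_order \<eta> (\<lambda>\<rho>. mat c)"
  by (rule full_orderI[OF _ fiber_order_const[of _ c] fiber_order_const[of _ 0]]) (simp add: mat_0)

lemma full_order_t: "full_order \<eta> mat_t"
  by (rule full_orderI[OF _ fiber_order_const[of _ 0] fiber_order_const[of _ 1]]) (simp add: mat_0)

lemma full_order_add:
  assumes "full_order \<eta> F" "full_order \<eta> F'"
  shows "full_order \<eta> (\<lambda>\<rho>. F \<rho> + F' \<rho>)"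
proof -
  obtain G H G' H' where *: "fiber_order \<eta> G" "fiber_order \<eta> H" "fiber_order \<eta> G'" "fiber_order \<eta> H'"
    "\<And>\<rho>. \<rho> \<in> good_reps \<eta> \<Longrightarrow> F \<rho> = G \<rho> + H \<rho> ** mat_t \<rho>"
    "\<And>\<rho>. \<rho> \<in> good_reps \<eta> \<Longrightarrow> F' \<rho> = G' \<rho> + H' \<rho> ** mat_t \<rho>"
    using full_orderE[OF assms(1)] full_orderE[OF assms(2)] by metis
  show ?thesis
    by (rule full_orderI[OF _ fiber_order_add[OF *(1,3)] fiber_order_add[OF *(2,4)]])
      (simp add: * matrix_mult_add)
qed

lemma full_order_scale:
  assumes "regular_on_good \<eta> f" "full_order \<eta> F"
  shows "full_order \<eta> (\<lambda>\<rho>. mat (f \<rho>) ** F \<rho>)"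
proof -
  obtain G H where *: "fiber_order \<eta> G" "fiber_order \<eta> H"
    "\<And>\<rho>. \<rho> \<in> good_reps \<eta> \<Longrightarrow> F \<rho> = G \<rho> + H \<rho> ** mat_t \<rho>"
    using full_orderE[OF assms(2)] by metis
  show ?thesis
    by (rule full_orderI[OF _ fiber_order_scale[OF assms(1) *(1)] fiber_order_scale[OF assms(1) *(2)]])
      (simp add: * matrix_mult_add matrix_mul_assoc)
qed

lemma full_order_mult_a:
  assumes "full_order \<eta> F"
  shows "full_order \<eta> (\<lambda>\<rho>. mat_a \<rho> ** F \<rho>)"
proof -
  obtain G H where *: "fiber_order \<eta> G" "fiber_order \<eta> H"
    "\<And>\<rho>. \<rho> \<in> good_reps \<eta> \<Longrightarrow> F \<rho> = G \<rho> + H \<rho> ** mat_t \<rho>"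
    using full_orderE[OF assms] by metis
  show ?thesis
    by (rule full_orderI[OF _ fiber_order_mult_a[OF *(1)] fiber_order_mult_a[OF *(2)]])
      (simp add: * matrix_mult_add matrix_mul_assoc)
qed

lemma full_order_mult_b:
  assumes "full_order \<eta> F"
  shows "full_order \<eta> (\<lambda>\<rho>. mat_b \<rho> ** F \<rho>)"
proof -
  obtain G H where *: "fiber_order \<eta> G" "fiber_order \<eta> H"
    "\<And>\<rho>. \<rho> \<in> good_reps \<eta> \<Longrightarrow> F \<rho> = G \<rho> + H \<rho> ** mat_t \<rho>"
    using full_orderE[OF assms] by metis
  show ?thesis
    by (rule full_orderI[OF _ fiber_order_mult_b[OF *(1)] fiber_order_mult_b[OF *(2)]])
      (simp add: * matrix_mult_add matrix_mul_assoc)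
qed

text \<open>On good representations this is the conjugate of A by T, the matrix \<open>M\<close> of
  \<open>bundle_triple\<close>; likewise \<open>conj_b\<close> is the conjugate of B by T.\<close>

definition conj_a :: "(generator word set \<Rightarrow> complex^2^2) \<Rightarrow> complex^2^2" where
  "conj_a \<rho> = comb (mat_a \<rho>) (mat_b \<rho>) (y_of \<rho> * z_of \<rho>) (- 1) (- z_of \<rho>) 0"

definition conj_b :: "(generator word set \<Rightarrow> complex^2^2) \<Rightarrow> complex^2^2" where
  "conj_b \<rho> = mat_b \<rho> ** mat_a \<rho> ** conj_a \<rho> ** conj_a \<rho> ** conj_a \<rho>"

lemma full_order_conj_a:
  assumes "full_order \<eta> F"
  shows "full_order \<eta> (\<lambda>\<rho>. conj_a \<rho> ** F \<rho>)"
proof (rule full_order_cong)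
  show "full_order \<eta> (\<lambda>\<rho>. mat (y_of \<rho> * z_of \<rho>) ** F \<rho> + (mat (- 1) ** (mat_a \<rho> ** F \<rho>)
      + mat (- z_of \<rho>) ** (mat_b \<rho> ** F \<rho>)))"
    by (intro full_order_add full_order_scale full_order_mult_a full_order_mult_b assms regular_intros)
  show "conj_a \<rho> ** F \<rho> = mat (y_of \<rho> * z_of \<rho>) ** F \<rho> + (mat (- 1) ** (mat_a \<rho> ** F \<rho>)
      + mat (- z_of \<rho>) ** (mat_b \<rho> ** F \<rho>))" for \<rho>
    by (simp add: conj_a_def comb_def mat_0 matrix_mult_add matrix_mul_assoc)
qed

lemma full_order_conj_b:
  assumes "full_order \<eta> F"
  shows "full_order \<eta> (\<lambda>\<rho>. conj_b \<rho> ** F \<rho>)"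
  unfolding conj_b_def matrix_mul_assoc[symmetric]
  by (intro full_order_mult_a full_order_mult_b full_order_conj_a assms)

text \<open>T passes through G when A and B are replaced by their conjugates. The second property
  records G' through its action by left multiplication, the form in which it is applied.\<close>

lemma conj_t:
  assumes "fiber_order \<eta> G"
  obtains G' where "\<And>\<rho>. \<rho> \<in> good_reps \<eta> \<Longrightarrow> mat_t \<rho> ** G \<rho> = G' \<rho> ** mat_t \<rho>"
    "\<And>F. full_order \<eta> F \<Longrightarrow> full_order \<eta> (\<lambda>\<rho>. G' \<rho> ** F \<rho>)"
proof -
  obtain p q r s where G:
    "regular_on_good \<eta> p" "regular_on_good \<eta> q" "regular_on_good \<eta> r" "regular_on_good \<eta> s"
    "\<And>\<rho>. \<rho> \<in> good_reps \<eta> \<Longrightarrow> G \<rho> = comb (mat_a \<rho>) (mat_b \<rho>) (p \<rho>) (q \<rho>) (r \<rho>) (s \<rho>)"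
    using fiber_orderE[OF assms] by blast
  show thesis
  proof (rule that)
    fix \<rho> assume \<rho>: "\<rho> \<in> good_reps \<eta>"
    interpret bundle_triple "mat_a \<rho>" "mat_b \<rho>" "mat_t \<rho>"
      using \<rho> by (rule good_reps_bundle_triple)
    have a: "mat_t \<rho> ** mat_a \<rho> = conj_a \<rho> ** mat_t \<rho>"
      unfolding T_A conj_a_def ..
    have b: "mat_t \<rho> ** mat_b \<rho> = conj_b \<rho> ** mat_t \<rho>"
      unfolding T_B conj_b_def conj_a_def ..
    have ab: "mat_t \<rho> ** (mat_a \<rho> ** mat_b \<rho>) = conj_a \<rho> ** (conj_b \<rho> ** mat_t \<rho>)"
      by (metis a b matrix_mul_assoc)
    have pull: "mat_t \<rho> ** (mat c ** N) = mat c ** (mat_t \<rho> ** N)" for c N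
      by (simp only: matrix_mul_assoc mat_mult_commute[of "mat_t \<rho>"])
    have "mat_t \<rho> ** G \<rho> = mat (p \<rho>) ** mat_t \<rho> + mat (q \<rho>) ** (mat_t \<rho> ** mat_a \<rho>)
        + mat (r \<rho>) ** (mat_t \<rho> ** mat_b \<rho>) + mat (s \<rho>) ** (mat_t \<rho> ** (mat_a \<rho> ** mat_b \<rho>))"
      using G(5) \<rho> by (simp add: comb_def matrix_mult_add pull mat_mult_commute)
    also have "\<dots> = (mat (p \<rho>) + mat (q \<rho>) ** conj_a \<rho> + mat (r \<rho>) ** conj_b \<rho>
        + mat (s \<rho>) ** (conj_a \<rho> ** conj_b \<rho>)) ** mat_t \<rho>"
      unfolding a b ab by (simp only: matrix_mult_add matrix_mul_assoc)
    finally show "mat_t \<rho> ** G \<rho> = (mat (p \<rho>) + mat (q \<rho>) ** conj_a \<rho> + mat (r \<rho>) ** conj_b \<rho>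
        + mat (s \<rho>) ** (conj_a \<rho> ** conj_b \<rho>)) ** mat_t \<rho>" .
  next
    fix F assume "full_order \<eta> F"
    then show "full_order \<eta> (\<lambda>\<rho>. (mat (p \<rho>) + mat (q \<rho>) ** conj_a \<rho> + mat (r \<rho>) ** conj_b \<rho>
        + mat (s \<rho>) ** (conj_a \<rho> ** conj_b \<rho>)) ** F \<rho>)"
      unfolding matrix_mult_add matrix_mul_assoc[symmetric]
      by (intro full_order_add full_order_scale full_order_conj_a full_order_conj_b G)
  qed
qed

lemma regular_trace_t: "regular_on_good \<eta> (\<lambda>\<rho>. trace (mat_t \<rho>))"
proof (rule regular_cong)
  show "regular_on_good \<eta> (\<lambda>\<rho>. \<eta> / 2 * z_of \<rho> * z_of \<rho>)" by (intro regular_intros)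
qed (rule good_reps_traces)

lemma cayley_hamilton_det_1:
  fixes A :: "complex^2^2"
  assumes "det A = 1"
  shows "A ** A = mat (trace A) ** A + mat (- 1)"
proof -
  have "A$1$1 * A$2$2 = 1 + A$1$2 * A$2$1" using assms by (simp add: det_2 algebra_simps)
  then show ?thesis by (simp add: mat2_simps algebra_simps)
qed

text \<open>Here T(G + HT) = G'T + H'T^2, and Cayley-Hamilton lowers T^2 because tr(T) is polynomial
  in y and z.\<close>

lemma full_order_mult_t:
  assumes "full_order \<eta> F"
  shows "full_order \<eta> (\<lambda>\<rho>. mat_t \<rho> ** F \<rho>)"
proof -
  obtain G H where *: "fiber_order \<eta> G" "fiber_order \<eta> H"
    "\<And>\<rho>. \<rho> \<in> good_reps \<eta> \<Longrightarrow> F \<rho> = G \<rho> + H \<rho> ** mat_t \<rho>"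
    using full_orderE[OF assms] by metis
  obtain G' where G': "\<And>\<rho>. \<rho> \<in> good_reps \<eta> \<Longrightarrow> mat_t \<rho> ** G \<rho> = G' \<rho> ** mat_t \<rho>"
    "\<And>F. full_order \<eta> F \<Longrightarrow> full_order \<eta> (\<lambda>\<rho>. G' \<rho> ** F \<rho>)"
    using conj_t[OF *(1)] by blast
  obtain H' where H': "\<And>\<rho>. \<rho> \<in> good_reps \<eta> \<Longrightarrow> mat_t \<rho> ** H \<rho> = H' \<rho> ** mat_t \<rho>"
    "\<And>F. full_order \<eta> F \<Longrightarrow> full_order \<eta> (\<lambda>\<rho>. H' \<rho> ** F \<rho>)"
    using conj_t[OF *(2)] by blast
  show ?thesis
  proof (rule full_order_cong)
    show "full_order \<eta> (\<lambda>\<rho>. G' \<rho> ** mat_t \<rho> + H' \<rho> ** (mat (trace (mat_t \<rho>)) ** mat_t \<rho> + mat (- 1)))"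
      by (intro full_order_add G' H' full_order_scale full_order_t full_order_const regular_trace_t)
    fix \<rho> assume \<rho>: "\<rho> \<in> good_reps \<eta>"
    have "mat_t \<rho> ** F \<rho> = G' \<rho> ** mat_t \<rho> + H' \<rho> ** (mat_t \<rho> ** mat_t \<rho>)"
      using G'(1)[OF \<rho>] H'(1)[OF \<rho>] by (simp add: *(3)[OF \<rho>] matrix_mult_add matrix_mul_assoc)
    then show "mat_t \<rho> ** F \<rho> =
        G' \<rho> ** mat_t \<rho> + H' \<rho> ** (mat (trace (mat_t \<rho>)) ** mat_t \<rho> + mat (- 1))"
      using cayley_hamilton_det_1[OF good_reps_det[OF \<rho>]] by simp
  qed
qed

lemma full_order_mult_gen:
  assumes "full_order \<eta> F"
  shows "full_order \<eta> (\<lambda>\<rho>. \<rho> (piN_gen g) ** F \<rho>)"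
  using assms by (cases g) (auto intro: full_order_mult_a full_order_mult_b full_order_mult_t)

lemma regular_trace_gen: "regular_on_good \<eta> (\<lambda>\<rho>. trace (\<rho> (piN_gen g)))"
  by (cases g) (auto intro: regular_x regular_y regular_trace_t)

text \<open>Induction over words; the inverse of a generator acts as its trace minus the
  generator.\<close>

lemma full_order_representations:
  assumes "\<gamma> \<in> carrier piN"
  shows "full_order \<eta> (\<lambda>\<rho>. \<rho> \<gamma>)"
  using assms
proof (induction rule: piN_induct)
  case one
  show ?case
    by (rule full_order_cong[OF full_order_const[of _ 1]]) (simp add: good_reps_def representations_one)
next
  case (gen g \<delta>)
  show ?case
    by (rule full_order_cong[OF full_order_mult_gen[OF gen(2)]])
      (simp add: good_reps_def representations_mult gen(1))
next
  case (inv g \<delta>)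
  show ?case
  proof (rule full_order_cong)
    show "full_order \<eta> (\<lambda>\<rho>. mat (trace (\<rho> (piN_gen g))) ** \<rho> \<delta> + mat (- 1) ** (\<rho> (piN_gen g) ** \<rho> \<delta>))"
      by (intro full_order_add full_order_scale full_order_mult_gen inv(2) regular_trace_gen regular_const)
    fix \<rho> assume "\<rho> \<in> good_reps \<eta>"
    then have \<rho>: "\<rho> \<in> representations piN" by (simp add: good_reps_def)
    have "\<rho> (inv\<^bsub>piN\<^esub> piN_gen g) = mat (trace (\<rho> (piN_gen g))) - \<rho> (piN_gen g)"
      using inverse_2_2(1)[OF representations_det[OF \<rho>] disjI1[OF representations_inv[OF \<rho>]]] by simp
    also have "\<dots> = mat (trace (\<rho> (piN_gen g))) + mat (- 1) ** \<rho> (piN_gen g)"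
      by (simp add: mat2_simps)
    finally show "\<rho> (inv\<^bsub>piN\<^esub> piN_gen g \<otimes>\<^bsub>piN\<^esub> \<delta>) =
        mat (trace (\<rho> (piN_gen g))) ** \<rho> \<delta> + mat (- 1) ** (\<rho> (piN_gen g) ** \<rho> \<delta>)"
      using inv(1) by (simp add: representations_mult[OF \<rho>] matrix_mult_add matrix_mul_assoc)
  qed
qed

text \<open>The trace of G + HT is a polynomial combination of the traces of 1, A, B, AB and T, AT,
  BT, ABT, and \<open>good_reps_traces\<close> supplies the last four.\<close>

lemma trace_regular:
  assumes "full_order \<eta> F"
  shows "regular_on_good \<eta> (\<lambda>\<rho>. trace (F \<rho>))"
proof -
  obtain G H where *: "fiber_order \<eta> G" "fiber_order \<eta> H"
    "\<And>\<rho>. \<rho> \<in> good_reps \<eta> \<Longrightarrow> F \<rho> = G \<rho> + H \<rho> ** mat_t \<rho>"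
    using full_orderE[OF assms] by metis
  obtain p q r s where G:
    "regular_on_good \<eta> p" "regular_on_good \<eta> q" "regular_on_good \<eta> r" "regular_on_good \<eta> s"
    "\<And>\<rho>. \<rho> \<in> good_reps \<eta> \<Longrightarrow> G \<rho> = comb (mat_a \<rho>) (mat_b \<rho>) (p \<rho>) (q \<rho>) (r \<rho>) (s \<rho>)"
    using fiber_orderE[OF *(1)] by blast
  obtain p' q' r' s' where H:
    "regular_on_good \<eta> p'" "regular_on_good \<eta> q'" "regular_on_good \<eta> r'" "regular_on_good \<eta> s'"
    "\<And>\<rho>. \<rho> \<in> good_reps \<eta> \<Longrightarrow> H \<rho> = comb (mat_a \<rho>) (mat_b \<rho>) (p' \<rho>) (q' \<rho>) (r' \<rho>) (s' \<rho>)"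
    using fiber_orderE[OF *(2)] by blast
  show ?thesis
  proof (rule regular_cong)
    show "regular_on_good \<eta> (\<lambda>\<rho>. 2 * p \<rho> + q \<rho> * trace (mat_a \<rho>) + r \<rho> * y_of \<rho> + s \<rho> * z_of \<rho> +
      (p' \<rho> * (\<eta> / 2 * z_of \<rho> * z_of \<rho>) + q' \<rho> * (\<eta> / 2 * y_of \<rho> * z_of \<rho>) +
       r' \<rho> * (\<eta> / 2 * (z_of \<rho> * z_of \<rho> - 2) * y_of \<rho>) + s' \<rho> * (\<eta> * z_of \<rho>)))"
      by (intro regular_intros regular_x G H)
    show "trace (F \<rho>) = 2 * p \<rho> + q \<rho> * trace (mat_a \<rho>) + r \<rho> * y_of \<rho> + s \<rho> * z_of \<rho> +
      (p' \<rho> * (\<eta> / 2 * z_of \<rho> * z_of \<rho>) + q' \<rho> * (\<eta> / 2 * y_of \<rho> * z_of \<rho>) +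
       r' \<rho> * (\<eta> / 2 * (z_of \<rho> * z_of \<rho> - 2) * y_of \<rho>) + s' \<rho> * (\<eta> * z_of \<rho>))"
      if "\<rho> \<in> good_reps \<eta>" for \<rho>
      using that by (simp add: * G(5) H(5) trace_add trace_comb trace_comb_mult good_reps_traces[OF that])
  qed
qed

lemma character_good_reps:
  "\<rho> \<in> good_reps \<eta> \<Longrightarrow> character piN \<rho> \<in> character_variety piN"
  by (simp add: good_reps_def character_variety_def)

lemma coordinate_ring_regular:
  assumes "f \<in> coordinate_ring piN (character_variety piN)"
  shows "regular_on_good \<eta> (\<lambda>\<rho>. f (character piN \<rho>))"
  using assms unfolding coordinate_ring_def
proof induction
  case (gen_const c)
  show ?case
    by (rule regular_cong[OF regular_const[of _ c]]) (simp add: character_good_reps)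
next
  case (gen_base f)
  then obtain \<gamma> where \<gamma>: "\<gamma> \<in> carrier piN" "f = trace_fun (character_variety piN) \<gamma>" by blast
  show ?case
    by (rule regular_cong[OF trace_regular[OF full_order_representations[OF \<gamma>(1)]]])
      (use \<gamma> character_good_reps in \<open>simp add: trace_fun_def, simp add: character_def\<close>)
next
  case (gen_add f g)
  show ?case
    by (rule regular_cong[OF regular_add[OF gen_add(3,4)]])
      (simp add: character_good_reps)
next
  case (gen_mult f g)
  show ?case
    by (rule regular_cong[OF regular_mult[OF gen_mult(3,4)]])
      (simp add: character_good_reps)
qed

section \<open>The curve of generic characters\<close>

lemma poly_eq_0_if_generic:
  fixes p q :: "complex poly"
  assumes "\<And>w. poly q w \<noteq> 0 \<Longrightarrow> poly p w = 0" "q \<noteq> 0"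
  shows "p = 0"
proof -
  have "poly (q * p) w = 0" for w using assms(1)[of w] by auto
  then have "q * p = 0" using poly_all_0_iff_0 by blast
  then show ?thesis using assms(2) by simp
qed

text \<open>The conic \<open>(yz)\<^sup>2 - 2z\<^sup>2 = 8\<close> factors as \<open>(yz/\<surd>2 - z)(yz/\<surd>2 + z) = 4\<close>; the parameter \<open>w\<close> is half
  of the first factor. The simplifier rewrites \<open>csqrt 2\<close>, hence the constant for it.\<close>

definition root_2 :: complex where "root_2 = csqrt 2"

lemma root_2: "root_2\<^sup>2 = 2" "root_2 \<noteq> 0"
proof -
  show 1: "root_2\<^sup>2 = 2" unfolding root_2_def by (rule power2_csqrt)
  then show "root_2 \<noteq> 0" by auto
qed

definition curve_y :: "complex \<Rightarrow> complex" where "curve_y w = root_2 * (1 + w\<^sup>2) / (1 - w\<^sup>2)"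
definition curve_z :: "complex \<Rightarrow> complex" where "curve_z w = (1 - w\<^sup>2) / w"

lemma curve_parametrization:
  assumes "w \<noteq> 0" "w\<^sup>2 \<noteq> 1"
  shows "(curve_z w)\<^sup>2 * ((curve_y w)\<^sup>2 - 2) = 8"
proof -
  have *: "(d / w)\<^sup>2 * ((root_2 * e / d)\<^sup>2 - 2) = (2 * e\<^sup>2 - 2 * d\<^sup>2) / w\<^sup>2" if "d \<noteq> 0" for d e
    using that assms(1) by (simp add: power_divide power_mult_distrib root_2 field_simps)
  have "1 - w\<^sup>2 \<noteq> 0" using assms by simp
  from *[OF this] have "(curve_z w)\<^sup>2 * ((curve_y w)\<^sup>2 - 2) = (2 * (1 + w\<^sup>2)\<^sup>2 - 2 * (1 - w\<^sup>2)\<^sup>2) / w\<^sup>2"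
    by (simp only: curve_y_def curve_z_def)
  also have "2 * (1 + w\<^sup>2)\<^sup>2 - 2 * (1 - w\<^sup>2)\<^sup>2 = 8 * w\<^sup>2" by algebra
  finally show ?thesis using assms(1) by simp
qed

lemma curve_parametrization_surj:
  assumes "z\<^sup>2 * (y\<^sup>2 - 2) = 8"
  obtains w where "w \<noteq> 0" "w\<^sup>2 \<noteq> 1" "y = curve_y w" "z = curve_z w"
proof -
  define w v where "w = (y * z / root_2 - z) / 2" and "v = (y * z / root_2 + z) / 2"
  have "w * v = ((y * z)\<^sup>2 / root_2\<^sup>2 - z\<^sup>2) / 4"
    unfolding w_def v_def using root_2(2) by (simp add: field_simps power2_eq_square)
  also have "(y * z)\<^sup>2 = 8 + 2 * z\<^sup>2" using assms by (simp add: power_mult_distrib algebra_simps)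
  finally have wv: "w * v = 1" by (simp add: root_2 field_simps)
  then have w0: "w \<noteq> 0" by auto
  with wv have w: "w \<noteq> 0" "v = 1 / w" by (auto simp: eq_divide_eq mult.commute)
  have "z = v - w" by (simp add: w_def v_def field_simps)
  then have z: "z = curve_z w" by (simp add: curve_z_def w field_simps power2_eq_square)
  have z0: "z \<noteq> 0" using assms by auto
  then have w2: "w\<^sup>2 \<noteq> 1" using z by (auto simp: curve_z_def)
  have "y * z = root_2 * (v + w)" using root_2(2) by (simp add: w_def v_def field_simps)
  then have "y = root_2 * (v + w) / z" using z0 by (simp add: field_simps)
  also have "\<dots> = curve_y w" using w w2 by (simp add: z curve_z_def curve_y_def field_simps power2_eq_square)
  finally show thesis using that w w2 z by blast
qed

text \<open>Rational functions of the parameter with poles only at the excluded values 0, 1 and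
  -1.\<close>

definition rational_fun :: "(complex \<Rightarrow> complex) \<Rightarrow> bool" where
  "rational_fun f \<longleftrightarrow> (\<exists>q N. \<forall>w. w \<noteq> 0 \<and> w\<^sup>2 \<noteq> 1 \<longrightarrow> f w * (w * (1 - w\<^sup>2)) ^ N = poly q w)"

lemma rational_const: "rational_fun (\<lambda>w. c)"
  unfolding rational_fun_def by (rule exI[of _ "[:c:]"], rule exI[of _ 0]) simp

lemma rational_add:
  assumes "rational_fun f" "rational_fun g"
  shows "rational_fun (\<lambda>w. f w + g w)"
proof -
  define D :: "complex poly" where "D = [:0, 1:] * (1 - [:0, 1:]\<^sup>2)"
  have D: "poly D w = w * (1 - w\<^sup>2)" for w by (simp add: D_def)
  obtain p M q N where "\<forall>w. w \<noteq> 0 \<and> w\<^sup>2 \<noteq> 1 \<longrightarrow> f w * poly D w ^ M = poly p w"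
    "\<forall>w. w \<noteq> 0 \<and> w\<^sup>2 \<noteq> 1 \<longrightarrow> g w * poly D w ^ N = poly q w"
    using assms unfolding rational_fun_def D by blast
  moreover have "(f w + g w) * poly D w ^ (M + N) =
      f w * poly D w ^ M * poly D w ^ N + g w * poly D w ^ N * poly D w ^ M" for w
    by (simp add: power_add algebra_simps)
  ultimately have "\<forall>w. w \<noteq> 0 \<and> w\<^sup>2 \<noteq> 1 \<longrightarrow> (f w + g w) * poly D w ^ (M + N) = poly (p * D ^ N + q * D ^ M) w"
    by simp
  then show ?thesis unfolding rational_fun_def D by blast
qed

lemma rational_mult:
  assumes "rational_fun f" "rational_fun g"
  shows "rational_fun (\<lambda>w. f w * g w)"
proof -
  obtain p M q N where "\<forall>w. w \<noteq> 0 \<and> w\<^sup>2 \<noteq> 1 \<longrightarrow> f w * (w * (1 - w\<^sup>2)) ^ M = poly p w"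
    "\<forall>w. w \<noteq> 0 \<and> w\<^sup>2 \<noteq> 1 \<longrightarrow> g w * (w * (1 - w\<^sup>2)) ^ N = poly q w"
    using assms unfolding rational_fun_def by blast
  moreover have "f w * g w * d ^ (M + N) = (f w * d ^ M) * (g w * d ^ N)" for d w
    by (simp add: power_add)
  ultimately have "\<forall>w. w \<noteq> 0 \<and> w\<^sup>2 \<noteq> 1 \<longrightarrow> f w * g w * (w * (1 - w\<^sup>2)) ^ (M + N) = poly (p * q) w"
    by (metis poly_mult)
  then show ?thesis unfolding rational_fun_def by blast
qed

lemma rational_eval2: "rational_fun (\<lambda>w. eval2 P (curve_y w) (curve_z w))"
proof -
  have z: "rational_fun curve_z"
    unfolding rational_fun_def
    by (rule exI[of _ "(1 - [:0, 1:]\<^sup>2)\<^sup>2"], rule exI[of _ 1])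
      (simp add: curve_z_def power2_eq_square)
  have y: "rational_fun curve_y"
    unfolding rational_fun_def
    by (rule exI[of _ "[:root_2:] * [:0, 1:] * (1 + [:0, 1:]\<^sup>2)"], rule exI[of _ 1])
      (simp add: curve_y_def)
  have a: "rational_fun (\<lambda>w. poly a (curve_z w))" for a
  proof (induction a)
    case 0
    then show ?case by (simp add: rational_const)
  next
    case (pCons c a)
    then show ?case by (simp add: rational_add rational_mult rational_const z)
  qed
  show ?thesis
  proof (induction P)
    case 0
    then show ?case by (simp add: eval2_def rational_const)
  next
    case (pCons c P)
    have "eval2 (pCons c P) v u = poly c u + v * eval2 P v u" for u v
      by (simp add: eval2_def)
    then show ?case using pCons by (simp add: rational_add rational_mult a y)
  qed
qed

text \<open>This is the irreducibility of the curve. On the parameter line, cleared of denominators,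
  f and g become polynomials p and q. Their product vanishes at every parameter that comes from a
  good representation, hence identically, and the polynomial ring is a domain.\<close>

lemma regular_product_zero:
  assumes \<eta>: "\<eta>\<^sup>2 = - 1" and "regular_on_good \<eta> f" "regular_on_good \<eta> g"
    and 0: "\<And>\<rho>. \<rho> \<in> good_reps \<eta> \<Longrightarrow> f \<rho> * g \<rho> = 0"
  shows "(\<forall>\<rho>\<in>good_reps \<eta>. f \<rho> = 0) \<or> (\<forall>\<rho>\<in>good_reps \<eta>. g \<rho> = 0)"
proof -
  obtain P Q where P: "\<And>\<rho>. \<rho> \<in> good_reps \<eta> \<Longrightarrow> f \<rho> = eval2 P (y_of \<rho>) (z_of \<rho>)"
    and Q: "\<And>\<rho>. \<rho> \<in> good_reps \<eta> \<Longrightarrow> g \<rho> = eval2 Q (y_of \<rho>) (z_of \<rho>)"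
    using assms(2,3) unfolding regular_on_good_def by blast
  obtain p M where p: "\<And>w. w \<noteq> 0 \<and> w\<^sup>2 \<noteq> 1 \<Longrightarrow>
      eval2 P (curve_y w) (curve_z w) * (w * (1 - w\<^sup>2)) ^ M = poly p w"
    using rational_eval2[of P] unfolding rational_fun_def by blast
  obtain q N where q: "\<And>w. w \<noteq> 0 \<and> w\<^sup>2 \<noteq> 1 \<Longrightarrow>
      eval2 Q (curve_y w) (curve_z w) * (w * (1 - w\<^sup>2)) ^ N = poly q w"
    using rational_eval2[of Q] unfolding rational_fun_def by blast
  \<comment> \<open>The factors exclude w = 0, w^2 = 1, y = 0 and z^2 = 4, in this order; elsewhere
    \<open>good_reps_exist\<close> applies.\<close>
  define D :: "complex poly" where
    "D = [:0, 1:] * (1 - [:0, 1:]\<^sup>2) * (1 + [:0, 1:]\<^sup>2) * ((1 - [:0, 1:]\<^sup>2)\<^sup>2 - 4 * [:0, 1:]\<^sup>2)"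
  have "poly D 3 \<noteq> 0" by (simp add: D_def)
  then have "D \<noteq> 0" by auto
  have "p * q = 0"
  proof (rule poly_eq_0_if_generic[OF _ \<open>D \<noteq> 0\<close>])
    fix w assume "poly D w \<noteq> 0"
    then have w: "w \<noteq> 0" "1 - w\<^sup>2 \<noteq> 0" "1 + w\<^sup>2 \<noteq> 0" "(1 - w\<^sup>2)\<^sup>2 \<noteq> 4 * w\<^sup>2"
      by (auto simp: D_def)
    have "curve_y w \<noteq> 0" using w by (simp add: curve_y_def root_2)
    moreover have "(curve_z w)\<^sup>2 \<noteq> 4" using w by (simp add: curve_z_def power_divide field_simps)
    moreover have "w\<^sup>2 \<noteq> 1" using w by auto
    ultimately obtain \<rho> where \<rho>: "\<rho> \<in> good_reps \<eta>" "y_of \<rho> = curve_y w" "z_of \<rho> = curve_z w"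
      using good_reps_exist[OF curve_parametrization _ _ \<eta>] w(1) by metis
    have "eval2 P (curve_y w) (curve_z w) * eval2 Q (curve_y w) (curve_z w) = 0"
      using 0[OF \<rho>(1)] P[OF \<rho>(1)] Q[OF \<rho>(1)] \<rho> by simp
    then show "poly (p * q) w = 0"
      using p[of w] q[of w] w(1) \<open>w\<^sup>2 \<noteq> 1\<close> by auto
  qed
  then consider "p = 0" | "q = 0" by auto
  then show ?thesis
  proof cases
    case 1
    have "f \<rho> = 0" if \<rho>: "\<rho> \<in> good_reps \<eta>" for \<rho>
    proof -
      obtain w where w: "w \<noteq> 0" "w\<^sup>2 \<noteq> 1" "y_of \<rho> = curve_y w" "z_of \<rho> = curve_z w"
        using curve_parametrization_surj[OF good_reps_curve(1)[OF \<rho>]] by blast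
      then show ?thesis using p[of w] 1 P[OF \<rho>] by auto
    qed
    then show ?thesis by blast
  next
    case 2
    have "g \<rho> = 0" if \<rho>: "\<rho> \<in> good_reps \<eta>" for \<rho>
    proof -
      obtain w where w: "w \<noteq> 0" "w\<^sup>2 \<noteq> 1" "y_of \<rho> = curve_y w" "z_of \<rho> = curve_z w"
        using curve_parametrization_surj[OF good_reps_curve(1)[OF \<rho>]] by blast
      then show ?thesis using q[of w] 2 Q[OF \<rho>] by auto
    qed
    then show ?thesis by blast
  qed
qed

section \<open>Reduction of polynomials in \<open>y\<close> and \<open>z\<close> to the eight
  monomials\<close>

definition mod_fun :: "(nat \<Rightarrow> complex poly) \<Rightarrow> complex \<Rightarrow> complex \<Rightarrow> complex \<Rightarrow> complex" where
  "mod_fun c l y z = (\<Sum>n<8. poly (c n) l * (z ^ (n mod 4) * y ^ (n div 4)))"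

lemma mod_fun_expand:
  "mod_fun c l y z = poly (c 0) l + poly (c 1) l * z + poly (c 2) l * z\<^sup>2 + poly (c 3) l * z ^ 3
    + (poly (c 4) l + poly (c 5) l * z + poly (c 6) l * z\<^sup>2 + poly (c 7) l * z ^ 3) * y"
proof -
  have "{..<8::nat} = {0, 1, 2, 3, 4, 5, 6, 7}" by auto
  then show ?thesis by (simp add: mod_fun_def power2_eq_square power3_eq_cube algebra_simps)
qed

text \<open>The two equations tie l, y, z together on the curve, so this is membership in the span
  of the eight monomials over the polynomials in l.\<close>

definition module_form :: "(complex \<Rightarrow> complex \<Rightarrow> complex \<Rightarrow> complex) \<Rightarrow> bool" where
  "module_form f \<longleftrightarrow> (\<exists>c. \<forall>l y z. z\<^sup>2 * (y\<^sup>2 - 2) = 8 \<and> 2 * l = 2 * y\<^sup>2 + z\<^sup>2 - 8 \<longrightarrow> f l y z = mod_fun c l y z)"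

lemma module_form_add:
  assumes "module_form f" "module_form g"
  shows "module_form (\<lambda>l y z. f l y z + g l y z)"
proof -
  have "mod_fun c l y z + mod_fun d l y z = mod_fun (\<lambda>n. c n + d n) l y z" for c d l y z
    by (simp add: mod_fun_def sum.distrib algebra_simps)
  with assms show ?thesis unfolding module_form_def by metis
qed

lemma module_form_scale:
  assumes "module_form f"
  shows "module_form (\<lambda>l y z. poly p l * f l y z)"
proof -
  have "poly p l * mod_fun c l y z = mod_fun (\<lambda>n. p * c n) l y z" for c l y z
    by (simp add: mod_fun_def sum_distrib_left algebra_simps)
  with assms show ?thesis unfolding module_form_def by metis
qed

text \<open>Eliminating y^2 from the two equations leaves a quadratic equation for z^2 over the
  polynomials in l.\<close>

lemma curve_z_4:
  fixes l y z :: complex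
  assumes "z\<^sup>2 * (y\<^sup>2 - 2) = 8" "2 * l = 2 * y\<^sup>2 + z\<^sup>2 - 8"
  shows "z ^ 4 = 2 * (l + 2) * z\<^sup>2 - 16"
proof -
  have "z\<^sup>2 * (2 * y\<^sup>2) = 16 + 4 * z\<^sup>2" using assms(1) by (simp add: algebra_simps)
  moreover have "2 * y\<^sup>2 = 2 * l - z\<^sup>2 + 8" using assms(2) by simp
  ultimately have "z\<^sup>2 * (2 * l - z\<^sup>2 + 8) = 16 + 4 * z\<^sup>2" by simp
  then show ?thesis by (simp add: algebra_simps power4_eq_xxxx power2_eq_square)
qed

lemma module_form_mult_z:
  assumes "module_form f"
  shows "module_form (\<lambda>l y z. z * f l y z)"
proof -
  obtain c where c: "\<And>l y z. z\<^sup>2 * (y\<^sup>2 - 2) = 8 \<Longrightarrow> 2 * l = 2 * y\<^sup>2 + z\<^sup>2 - 8 \<Longrightarrow> f l y z = mod_fun c l y z"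
    using assms unfolding module_form_def by blast
  \<comment> \<open>Coefficients move up by one power of z, and z^4 is replaced by 2(l + 2) z^2 -
    16; \<open>[:4, 2:]\<close> is 2(l + 2).\<close>
  let ?d = "\<lambda>n. [- 16 * c 3, c 0, c 1 + [:4, 2:] * c 3, c 2, - 16 * c 7, c 4, c 5 + [:4, 2:] * c 7, c 6] ! n"
  have "z * f l y z = mod_fun ?d l y z" if "z\<^sup>2 * (y\<^sup>2 - 2) = 8" "2 * l = 2 * y\<^sup>2 + z\<^sup>2 - 8" for l y z
  proof -
    have "z ^ 4 = 2 * (l + 2) * z\<^sup>2 - 16" using curve_z_4 that .
    then show ?thesis
      unfolding c[OF that] mod_fun_expand by (simp add: eval_nat_numeral) algebra
  qed
  then show ?thesis unfolding module_form_def by blast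
qed

lemma module_form_mult_y:
  assumes "module_form f"
  shows "module_form (\<lambda>l y z. y * f l y z)"
proof -
  obtain c where c: "\<And>l y z. z\<^sup>2 * (y\<^sup>2 - 2) = 8 \<Longrightarrow> 2 * l = 2 * y\<^sup>2 + z\<^sup>2 - 8 \<Longrightarrow> f l y z = mod_fun c l y z"
    using assms unfolding module_form_def by blast
  \<comment> \<open>For f = u + vy with u, v free of y, \<open>C\<close> represents uy and
    \<open>D\<close> represents v. Then yf = uy + vy^2, where y^2 = l + 4 - z^2/2.\<close>
  define C where "C = (\<lambda>n::nat. if n < 4 then 0 else c (n - 4))"
  define D where "D = (\<lambda>n::nat. if n < 4 then c (n + 4) else 0)"
  have CD: "module_form (mod_fun C)" "module_form (mod_fun D)"
    unfolding module_form_def by blast+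
  have "module_form (\<lambda>l y z. mod_fun C l y z + (poly [:4, 1:] l * mod_fun D l y z
      + poly [:- (1 / 2):] l * (z * (z * mod_fun D l y z))))"
    by (intro module_form_add module_form_scale module_form_mult_z CD)
  moreover have "y * f l y z = mod_fun C l y z + (poly [:4, 1:] l * mod_fun D l y z
      + poly [:- (1 / 2):] l * (z * (z * mod_fun D l y z)))"
    if "z\<^sup>2 * (y\<^sup>2 - 2) = 8" "2 * l = 2 * y\<^sup>2 + z\<^sup>2 - 8" for l y z
  proof -
    have y2: "y * y = l + 4 - z * z / 2" using that(2) by (simp add: field_simps power2_eq_square)
    define u v where "u = poly (c 0) l + poly (c 1) l * z + poly (c 2) l * z\<^sup>2 + poly (c 3) l * z ^ 3"
      and "v = poly (c 4) l + poly (c 5) l * z + poly (c 6) l * z\<^sup>2 + poly (c 7) l * z ^ 3"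
    have "f l y z = u + v * y" unfolding c[OF that] mod_fun_expand u_def v_def ..
    moreover have "mod_fun C l y z = u * y" unfolding mod_fun_expand u_def by (simp add: C_def)
    moreover have "mod_fun D l y z = v" unfolding mod_fun_expand v_def by (simp add: D_def)
    moreover have "y * (u + v * y) = u * y + v * (y * y)" by (simp add: algebra_simps)
    ultimately show ?thesis unfolding y2 by (simp add: algebra_simps)
  qed
  ultimately show ?thesis unfolding module_form_def by metis
qed

lemma module_form_eval2: "module_form (\<lambda>l y z. eval2 P y z)"
proof -
  have 0: "module_form (\<lambda>l y z. poly p l)" for p
    unfolding module_form_def
    by (rule exI[of _ "\<lambda>n. if n = 0 then p else 0"]) (simp add: mod_fun_expand)
  have const: "module_form (\<lambda>l y z. b)" for b using 0[of "[:b:]"] by simp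
  have a: "module_form (\<lambda>l y z. poly a z)" for a
    by (induction a) (simp_all add: const module_form_add module_form_mult_z)
  show ?thesis
  proof (induction P)
    case 0
    then show ?case by (simp add: eval2_def const)
  next
    case (pCons b P)
    have "eval2 (pCons b P) v u = poly b u + v * eval2 P v u" for u v
      by (simp add: eval2_def)
    then show ?case using pCons by (simp add: module_form_add module_form_mult_y a)
  qed
qed

lemma regular_spanned:
  assumes "regular_on_good \<eta> f"
  shows "\<exists>c. \<forall>\<rho>\<in>good_reps \<eta>. f \<rho> = mod_fun c (l_of \<rho>) (y_of \<rho>) (z_of \<rho>)"
proof -
  obtain P where P: "\<And>\<rho>. \<rho> \<in> good_reps \<eta> \<Longrightarrow> f \<rho> = eval2 P (y_of \<rho>) (z_of \<rho>)"
    using assms unfolding regular_on_good_def by blast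
  obtain c where "\<And>l y z. z\<^sup>2 * (y\<^sup>2 - 2) = 8 \<Longrightarrow> 2 * l = 2 * y\<^sup>2 + z\<^sup>2 - 8 \<Longrightarrow> eval2 P y z = mod_fun c l y z"
    using module_form_eval2[of P] unfolding module_form_def by blast
  then have "\<forall>\<rho>\<in>good_reps \<eta>. f \<rho> = mod_fun c (l_of \<rho>) (y_of \<rho>) (z_of \<rho>)"
    using P good_reps_curve(1,4) by metis
  then show ?thesis by (intro exI[of _ c])
qed

text \<open>A generic fibre of l has eight points. Changing the signs of y and z separates the terms
  by their parities in y and z; the two coefficients left in each parity class are separated by the
  two values of z^2.\<close>

lemma mod_fun_independent:
  assumes \<eta>: "\<eta>\<^sup>2 = - 1"
    and 0: "\<And>\<rho>. \<rho> \<in> good_reps \<eta> \<Longrightarrow> mod_fun c (l_of \<rho>) (y_of \<rho>) (z_of \<rho>) = 0"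
    and "n < 8"
  shows "c n = 0"
proof (rule poly_eq_0_if_generic)
  \<comment> \<open>The quadratic for z^2 has discriminant 4(l - 2)(l + 6). Away from its zeros the
    two roots differ, and neither is 4, which good representations exclude, or -4, where y =
    0.\<close>
  show "[:- 2, 1:] * [:6, 1:] \<noteq> (0 :: complex poly)" by simp
  fix l :: complex assume "poly ([:- 2, 1:] * [:6, 1:]) l \<noteq> 0"
  then have l: "l \<noteq> 2" "l \<noteq> - 6" by (auto simp: algebra_simps)
  have vanish: "poly (c 0) l + poly (c 2) l * s = 0 \<and> poly (c 1) l + poly (c 3) l * s = 0
      \<and> poly (c 4) l + poly (c 6) l * s = 0 \<and> poly (c 5) l + poly (c 7) l * s = 0"
    if s: "s * s - 2 * (l + 2) * s + 16 = 0" for s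
  proof -
    have s0: "s \<noteq> 0" "s \<noteq> 4" "s \<noteq> - 4"
    proof -
      show "s \<noteq> 0" using s by auto
      show "s \<noteq> 4"
      proof
        assume "s = 4"
        then have "- 8 * (l - 2) = 0" using s by (simp add: algebra_simps)
        then show False using l by simp
      qed
      show "s \<noteq> - 4"
      proof
        assume "s = - 4"
        then have "8 * (l + 6) = 0" using s by (simp add: algebra_simps)
        then have "l + 6 = 0" unfolding mult_eq_0_iff by simp
        then show False using l by (simp add: eq_neg_iff_add_eq_0)
      qed
    qed
    define z where "z = csqrt s"
    \<comment> \<open>Solves z^2 (y^2 - 2) = 8 at z^2 = s.\<close>
    define y where "y = csqrt (2 + 8 / s)"
    have z2: "z\<^sup>2 = s" and y2: "y\<^sup>2 = 2 + 8 / s" by (simp_all add: z_def y_def)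
    have "z \<noteq> 0" using s0 z2 by auto
    have "2 + 8 / s \<noteq> 0"
    proof
      assume "2 + 8 / s = 0"
      then have "2 * (s - (- 4)) = 0" using s0(1) by (simp add: field_simps)
      then have "s = - 4" unfolding mult_eq_0_iff right_minus_eq by simp
      with s0(3) show False ..
    qed
    then have "y \<noteq> 0" using y2 by auto
    have l': "2 * l = 2 * y\<^sup>2 + z\<^sup>2 - 8" unfolding y2 z2 using s s0 by (simp add: field_simps)
    have pt: "mod_fun c l v u = 0" if "v = y \<or> v = - y" "u = z \<or> u = - z" for u v
    proof -
      have *: "u\<^sup>2 = s" "v\<^sup>2 = 2 + 8 / s" "v \<noteq> 0" using that z2 y2 \<open>y \<noteq> 0\<close> by auto
      then have "u\<^sup>2 * (v\<^sup>2 - 2) = 8" "u\<^sup>2 \<noteq> 4" using s0 by auto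
      then obtain \<rho> where \<rho>: "\<rho> \<in> good_reps \<eta>" "y_of \<rho> = v" "z_of \<rho> = u"
        using good_reps_exist[OF _ \<open>v \<noteq> 0\<close> _ \<eta>] by metis
      have "2 * l_of \<rho> = 2 * v\<^sup>2 + u\<^sup>2 - 8" using good_reps_curve(4)[OF \<rho>(1)] \<rho> by simp
      also have "\<dots> = 2 * l" unfolding l' y2 z2 * ..
      finally have "l_of \<rho> = l" by (simp only: mult_cancel_left) simp
      then show ?thesis using 0[OF \<rho>(1)] \<rho> by simp
    qed
    have z3: "z ^ 3 = z * s" using z2 by (simp add: power3_eq_cube power2_eq_square)
    define a0 a1 b0 b1 where "a0 = poly (c 0) l + poly (c 2) l * s" "a1 = poly (c 1) l + poly (c 3) l * s"
      "b0 = poly (c 4) l + poly (c 6) l * s" "b1 = poly (c 5) l + poly (c 7) l * s"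
    note ab = this
    have e: "mod_fun c l v u = a0 + a1 * u + (b0 + b1 * u) * v" if "u\<^sup>2 = s" for u v
    proof -
      have "u ^ 3 = u * s" using that by (simp add: power3_eq_cube power2_eq_square)
      then show ?thesis by (simp add: mod_fun_expand that ab algebra_simps)
    qed
    have "a0 + a1 * z + (b0 + b1 * z) * y = 0" "a0 + a1 * z - (b0 + b1 * z) * y = 0"
      "a0 - a1 * z + (b0 - b1 * z) * y = 0" "a0 - a1 * z - (b0 - b1 * z) * y = 0"
      using pt[of y z] pt[of "- y" z] pt[of y "- z"] pt[of "- y" "- z"] z2 by (simp_all add: e)
    then have "4 * a0 = 0" "4 * (a1 * z) = 0" "4 * (b0 * y) = 0" "4 * (b1 * z * y) = 0"
      by algebra+
    then have "a0 = 0" "a1 = 0" "b0 = 0" "b1 = 0" using \<open>y \<noteq> 0\<close> \<open>z \<noteq> 0\<close> by simp_all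
    then show ?thesis unfolding ab by blast
  qed
  define q where "q = csqrt ((l + 2)\<^sup>2 - 16)"
  have q2: "q * q = (l + 2) * (l + 2) - 16" using power2_csqrt[of "(l + 2)\<^sup>2 - 16"] by (simp add: q_def power2_eq_square)
  have q: "q \<noteq> 0"
  proof
    assume "q = 0"
    then have "(l - 2) * (l + 6) = 0" using q2 by (simp add: algebra_simps)
    then have "l - 2 = 0 \<or> l + 6 = 0" unfolding mult_eq_0_iff .
    then show False using l by (simp add: eq_neg_iff_add_eq_0)
  qed
  have "(l + 2 + q) * (l + 2 + q) - 2 * (l + 2) * (l + 2 + q) + 16 = 0"
    "(l + 2 - q) * (l + 2 - q) - 2 * (l + 2) * (l + 2 - q) + 16 = 0"
    using q2 by algebra+
  note v = vanish[OF this(1)] vanish[OF this(2)]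
  have lin: "a = 0 \<and> b = 0" if "a + b * (l + 2 + q) = 0" "a + b * (l + 2 - q) = 0" for a b
  proof -
    have "2 * (b * q) = 0" using that by algebra
    then have "b = 0" using q by simp
    then show ?thesis using that by simp
  qed
  have "poly (c 0) l = 0 \<and> poly (c 2) l = 0" "poly (c 1) l = 0 \<and> poly (c 3) l = 0"
    "poly (c 4) l = 0 \<and> poly (c 6) l = 0" "poly (c 5) l = 0 \<and> poly (c 7) l = 0"
    using v lin[of "poly (c 0) l" "poly (c 2) l"] lin[of "poly (c 1) l" "poly (c 3) l"]
      lin[of "poly (c 4) l" "poly (c 6) l"] lin[of "poly (c 5) l" "poly (c 7) l"] by blast+
  moreover have "n \<in> {0, 1, 2, 3, 4, 5, 6, 7}" using \<open>n < 8\<close> by auto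
  ultimately show "poly (c n) l = 0" by auto
qed

section \<open>Hyperbolic curves\<close>

lemma generated_algebra_poly:
  assumes "f \<in> generated_algebra X F"
  shows "(\<lambda>x\<in>X. poly p (f x)) \<in> generated_algebra X F"
proof (induction p)
  case 0
  then show ?case unfolding poly_0 by (rule gen_const)
next
  case (pCons c p)
  \<comment> \<open>The inner restrictions give the function the literal shape of the closure
    rules.\<close>
  have eq: "(\<lambda>x\<in>X. poly (pCons c p) (f x)) =
      (\<lambda>x\<in>X. (\<lambda>x\<in>X. c) x + (\<lambda>x\<in>X. f x * (\<lambda>x\<in>X. poly p (f x)) x) x)"
    by (intro restrict_ext) simp
  show ?case unfolding eq by (intro gen_add gen_mult gen_const assms pCons)
qed

lemma generated_algebra_singleton:
  assumes "f \<in> generated_algebra X {l}"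
  obtains p where "f = (\<lambda>x\<in>X. poly p (l x))"
proof -
  have "\<exists>p. f = (\<lambda>x\<in>X. poly p (l x))"
    using assms
  proof induction
    case (gen_const c)
    show ?case by (rule exI[of _ "[:c:]"]) simp
  next
    case (gen_base f)
    then show ?case by (intro exI[of _ "[:0, 1:]"]) simp
  next
    case (gen_add f g)
    then obtain p q where pq: "f = (\<lambda>x\<in>X. poly p (l x))" "g = (\<lambda>x\<in>X. poly q (l x))" by blast
    show ?case unfolding pq by (rule exI[of _ "p + q"]) (intro restrict_ext, simp)
  next
    case (gen_mult f g)
    then obtain p q where pq: "f = (\<lambda>x\<in>X. poly p (l x))" "g = (\<lambda>x\<in>X. poly q (l x))" by blast
    show ?case unfolding pq by (rule exI[of _ "p * q"]) (intro restrict_ext, simp)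
  qed
  then show thesis using that by blast
qed

lemma trace_fun_in_coordinate_ring:
  "\<gamma> \<in> carrier G \<Longrightarrow> trace_fun X \<gamma> \<in> coordinate_ring G X"
  using gen_base[of "trace_fun X \<gamma>" "trace_fun X ` carrier G" X]
  by (simp add: coordinate_ring_def trace_fun_def)

text \<open>Replaying on Y the construction of f from traces extends f to Y.\<close>

lemma coordinate_ring_restrict:
  assumes "X \<subseteq> Y" "f \<in> coordinate_ring G X"
  obtains g where "g \<in> coordinate_ring G Y" "f = restrict g X"
proof -
  have "\<exists>g \<in> generated_algebra Y (trace_fun Y ` carrier G). f = restrict g X"
    using assms(2) unfolding coordinate_ring_def
  proof induction
    case (gen_const c)
    show ?case
      by (rule bexI[OF _ generated_algebra.gen_const[of c Y]]) (use assms(1) in \<open>intro restrict_ext, auto\<close>)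
  next
    case (gen_base f)
    then obtain \<gamma> where "\<gamma> \<in> carrier G" "f = trace_fun X \<gamma>" by blast
    then have "trace_fun Y \<gamma> \<in> generated_algebra Y (trace_fun Y ` carrier G)"
      "restrict f X = restrict (trace_fun Y \<gamma>) X"
      using assms(1) trace_fun_in_coordinate_ring[of \<gamma> G Y]
      by (auto simp: coordinate_ring_def trace_fun_def restrict_def fun_eq_iff)
    then show ?case by blast
  next
    case (gen_add f g)
    then obtain f' g' where "f' \<in> generated_algebra Y (trace_fun Y ` carrier G)" "f = restrict f' X"
      "g' \<in> generated_algebra Y (trace_fun Y ` carrier G)" "g = restrict g' X" by blast
    then show ?case
      using assms(1)
      by (intro bexI[OF _ generated_algebra.gen_add[of f' _ _ g']] restrict_ext) auto
  next
    case (gen_mult f g)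
    then obtain f' g' where "f' \<in> generated_algebra Y (trace_fun Y ` carrier G)" "f = restrict f' X"
      "g' \<in> generated_algebra Y (trace_fun Y ` carrier G)" "g = restrict g' X" by blast
    then show ?case
      using assms(1)
      by (intro bexI[OF _ generated_algebra.gen_mult[of f' _ _ g']] restrict_ext) auto
  qed
  then show thesis using that unfolding coordinate_ring_def by blast
qed

section \<open>Algebraic sets, irreducibility and Zariski closure\<close>

lemma algebraic_subsetI:
  "F \<subseteq> coordinate_ring G (character_variety G) \<Longrightarrow>
    algebraic_subset G {x \<in> character_variety G. \<forall>f\<in>F. f x = 0}"
  unfolding algebraic_subset_def by blast

lemma algebraic_subset_subset: "algebraic_subset G Z \<Longrightarrow> Z \<subseteq> character_variety G"
  unfolding algebraic_subset_def by blast

lemma algebraic_subset_Int: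
  assumes "algebraic_subset G Z" "algebraic_subset G Z'"
  shows "algebraic_subset G (Z \<inter> Z')"
proof -
  obtain F F' where "F \<subseteq> coordinate_ring G (character_variety G)" "F' \<subseteq> coordinate_ring G (character_variety G)"
    "Z = {x \<in> character_variety G. \<forall>f\<in>F. f x = 0}" "Z' = {x \<in> character_variety G. \<forall>f\<in>F'. f x = 0}"
    using assms unfolding algebraic_subset_def by blast
  then show ?thesis
    unfolding algebraic_subset_def by (intro exI[of _ "F \<union> F'"]) auto
qed

lemma algebraic_subset_Un:
  assumes "algebraic_subset G Z" "algebraic_subset G Z'"
  shows "algebraic_subset G (Z \<union> Z')"
proof -
  let ?V = "character_variety G"
  obtain F F' where F: "F \<subseteq> coordinate_ring G ?V" "F' \<subseteq> coordinate_ring G ?V"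
    and Z: "Z = {x \<in> ?V. \<forall>f\<in>F. f x = 0}" "Z' = {x \<in> ?V. \<forall>f\<in>F'. f x = 0}"
    using assms unfolding algebraic_subset_def by blast
  \<comment> \<open>All products of an equation of Z with an equation of Z' vanish at a point only
    if one of the two systems does.\<close>
  let ?P = "{(\<lambda>x\<in>?V. f x * f' x) | f f'. f \<in> F \<and> f' \<in> F'}"
  have "?P \<subseteq> coordinate_ring G ?V"
    using F unfolding coordinate_ring_def by (auto intro!: gen_mult)
  moreover have "Z \<union> Z' = {x \<in> ?V. \<forall>f\<in>?P. f x = 0}"
  proof (intro equalityI subsetI)
    fix x assume x: "x \<in> {x \<in> ?V. \<forall>f\<in>?P. f x = 0}"
    show "x \<in> Z \<union> Z'"
    proof (rule ccontr)
      assume "x \<notin> Z \<union> Z'"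
      then obtain f f' where "f \<in> F" "f' \<in> F'" "f x \<noteq> 0" "f' x \<noteq> 0" using x Z by auto
      with x show False by fastforce
    qed
  qed (use Z in auto)
  ultimately show ?thesis unfolding algebraic_subset_def by blast
qed

lemma irreducible_subset_cases:
  assumes "irreducible_subset G X" "algebraic_subset G Z" "algebraic_subset G Z'" "X \<subseteq> Z \<union> Z'"
  shows "X \<subseteq> Z \<or> X \<subseteq> Z'"
proof -
  have "algebraic_subset G X" using assms(1) by (simp add: irreducible_subset_def)
  then have "algebraic_subset G (X \<inter> Z)" "algebraic_subset G (X \<inter> Z')"
    using assms(2,3) by (simp_all add: algebraic_subset_Int)
  moreover have "X = (X \<inter> Z) \<union> (X \<inter> Z')" using assms(4) by blast
  ultimately have "X = X \<inter> Z \<or> X = X \<inter> Z'"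
    using assms(1) unfolding irreducible_subset_def by blast
  then show ?thesis by blast
qed

definition zariski_closure :: "('a, 'b) monoid_scheme \<Rightarrow> ('a \<Rightarrow> complex) set \<Rightarrow> ('a \<Rightarrow> complex) set" where
  "zariski_closure G S = {x \<in> character_variety G.
     \<forall>f\<in>{f \<in> coordinate_ring G (character_variety G). \<forall>s\<in>S. f s = 0}. f x = 0}"

lemma algebraic_zariski_closure: "algebraic_subset G (zariski_closure G S)"
  unfolding zariski_closure_def by (rule algebraic_subsetI) blast

lemma zariski_closure_superset: "S \<subseteq> character_variety G \<Longrightarrow> S \<subseteq> zariski_closure G S"
  unfolding zariski_closure_def by blast

lemma zariski_closure_minimal:
  assumes "algebraic_subset G Z" "S \<subseteq> Z"
  shows "zariski_closure G S \<subseteq> Z"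
  using assms unfolding zariski_closure_def algebraic_subset_def by blast

text \<open>The last hypothesis is the primeness of the ideal of functions vanishing on S. If S were
  in neither closed piece, a function from each piece would violate it.\<close>

lemma irreducible_zariski_closure:
  assumes "S \<subseteq> character_variety G" "S \<noteq> {}"
    and "\<And>f g. f \<in> coordinate_ring G (character_variety G) \<Longrightarrow> g \<in> coordinate_ring G (character_variety G) \<Longrightarrow>
      \<forall>s\<in>S. f s * g s = 0 \<Longrightarrow> (\<forall>s\<in>S. f s = 0) \<or> (\<forall>s\<in>S. g s = 0)"
  shows "irreducible_subset G (zariski_closure G S)"
  unfolding irreducible_subset_def
proof (intro conjI allI impI)
  show "algebraic_subset G (zariski_closure G S)" by (rule algebraic_zariski_closure)
  show "zariski_closure G S \<noteq> {}" using zariski_closure_superset assms(1,2) by blast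
next
  fix Z Z' assume Z: "algebraic_subset G Z \<and> algebraic_subset G Z' \<and> zariski_closure G S = Z \<union> Z'"
  have S: "S \<subseteq> Z \<union> Z'" using zariski_closure_superset[OF assms(1)] Z by blast
  have "S \<subseteq> Z \<or> S \<subseteq> Z'"
  proof (rule ccontr)
    assume "\<not> (S \<subseteq> Z \<or> S \<subseteq> Z')"
    then obtain s s' where s: "s \<in> S" "s \<notin> Z" "s' \<in> S" "s' \<notin> Z'" by blast
    obtain F F' where F: "F \<subseteq> coordinate_ring G (character_variety G)" "Z = {x \<in> character_variety G. \<forall>f\<in>F. f x = 0}"
      and F': "F' \<subseteq> coordinate_ring G (character_variety G)" "Z' = {x \<in> character_variety G. \<forall>f\<in>F'. f x = 0}"
      using Z unfolding algebraic_subset_def by blast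
    obtain f f' where f: "f \<in> F" "f s \<noteq> 0" "f' \<in> F'" "f' s' \<noteq> 0"
      using s F F' assms(1) by blast
    have "\<forall>x\<in>S. f x * f' x = 0" using S f F(2) F'(2) by auto
    moreover have "f \<in> coordinate_ring G (character_variety G)" "f' \<in> coordinate_ring G (character_variety G)"
      using f F F' by blast+
    ultimately show False using assms(3)[of f f'] f s by blast
  qed
  then show "zariski_closure G S = Z \<or> zariski_closure G S = Z'"
    using zariski_closure_minimal Z by blast
qed

section \<open>Faithful characters and the hyperbolic curves\<close>

lemma good_reps_nonempty:
  assumes "\<eta>\<^sup>2 = - 1"
  obtains \<rho> where "\<rho> \<in> good_reps \<eta>"
proof -
  \<comment> \<open>The point of the curve with z = 1 and y a square root of 10.\<close>
  have "(csqrt 10)\<^sup>2 = 10" by (rule power2_csqrt)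
  then have "(1::complex)\<^sup>2 * ((csqrt 10)\<^sup>2 - 2) = 8" "csqrt 10 \<noteq> 0" "(1::complex)\<^sup>2 \<noteq> 4" by auto
  then show thesis using good_reps_exist[OF _ _ _ assms] that by metis
qed

text \<open>One good representation shows both. Since l is not 2, the images A and B do not commute;
  since x = yz/2 is nonzero, \<open>A_fourth_power_D\<close> then rules out A^4 = 1.\<close>

lemma piN_noncommuting:
  "piN_gen Alpha \<otimes>\<^bsub>piN\<^esub> piN_gen Beta \<noteq> piN_gen Beta \<otimes>\<^bsub>piN\<^esub> piN_gen Alpha"
  and piN_alpha_power: "piN_gen Alpha \<otimes>\<^bsub>piN\<^esub> piN_gen Alpha \<otimes>\<^bsub>piN\<^esub> piN_gen Alpha \<otimes>\<^bsub>piN\<^esub> piN_gen Alpha \<noteq> \<one>\<^bsub>piN\<^esub>"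
proof -
  obtain \<rho> where \<rho>: "\<rho> \<in> good_reps \<i>"
    by (rule good_reps_nonempty[of \<i>]) simp
  then have rep: "\<rho> \<in> representations piN" and l: "l_of \<rho> \<noteq> 2" by (simp_all add: good_reps_def)
  interpret bundle_triple "mat_a \<rho>" "mat_b \<rho>" "mat_t \<rho>"
    using \<rho> by (rule good_reps_bundle_triple)
  have nc: "mat_a \<rho> ** mat_b \<rho> \<noteq> mat_b \<rho> ** mat_a \<rho>"
    using l commute_l_eq_2 by blast
  show "piN_gen Alpha \<otimes>\<^bsub>piN\<^esub> piN_gen Beta \<noteq> piN_gen Beta \<otimes>\<^bsub>piN\<^esub> piN_gen Alpha"
    using nc representations_mult[OF rep] by (metis piN_gen_closed)
  have "x \<noteq> 0" using good_reps_curve(2,3,6)[OF \<rho>] by auto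
  then have "mat_a \<rho> ** mat_a \<rho> ** mat_a \<rho> ** mat_a \<rho> \<noteq> mat 1"
    using nc A_fourth_power_D by blast
  then show "piN_gen Alpha \<otimes>\<^bsub>piN\<^esub> piN_gen Alpha \<otimes>\<^bsub>piN\<^esub> piN_gen Alpha \<otimes>\<^bsub>piN\<^esub> piN_gen Alpha \<noteq> \<one>\<^bsub>piN\<^esub>"
    using representations_mult[OF rep] representations_one[OF rep]
    by (metis piN.m_closed piN_gen_closed)
qed

lemma discrete_faithful_good:
  assumes "discrete_faithful piN \<rho>"
  shows "y_of \<rho> \<noteq> 0" "l_of \<rho> \<noteq> 2"
proof -
  have rep: "\<rho> \<in> representations piN" and inj: "inj_on \<rho> (carrier piN)"
    using assms by (simp_all add: discrete_faithful_def)
  interpret bundle_triple "mat_a \<rho>" "mat_b \<rho>" "mat_t \<rho>"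
    using rep by (rule representations_bundle_triple)
  show y: "y \<noteq> 0"
  proof
    assume "y = 0"
    then have "\<rho> (piN_gen Alpha \<otimes>\<^bsub>piN\<^esub> piN_gen Alpha \<otimes>\<^bsub>piN\<^esub> piN_gen Alpha \<otimes>\<^bsub>piN\<^esub> piN_gen Alpha) = \<rho> \<one>\<^bsub>piN\<^esub>"
      using A_fourth_power by (simp add: representations_mult[OF rep] representations_one[OF rep])
    then show False using inj piN_alpha_power by (simp add: inj_on_eq_iff)
  qed
  show "l \<noteq> 2"
  proof
    assume "l = 2"
    then have "\<rho> (piN_gen Alpha \<otimes>\<^bsub>piN\<^esub> piN_gen Beta) = \<rho> (piN_gen Beta \<otimes>\<^bsub>piN\<^esub> piN_gen Alpha)"
      using l_eq_2_commute[OF y] by (simp add: representations_mult[OF rep])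
    then show False using inj piN_noncommuting by (simp add: inj_on_eq_iff)
  qed
qed

abbreviation (input) "peripheral \<equiv> commutator piN (piN_gen Alpha) (piN_gen Beta)"
abbreviation (input) "alpha_beta \<equiv> piN_gen Alpha \<otimes>\<^bsub>piN\<^esub> piN_gen Beta"

lemma peripheral_closed: "peripheral \<in> carrier piN"
  by (simp add: commutator_def)

lemma character_eval:
  assumes "\<rho> \<in> representations piN"
  shows "character piN \<rho> peripheral = l_of \<rho>" "character piN \<rho> (piN_gen Beta) = y_of \<rho>"
    "character piN \<rho> alpha_beta = z_of \<rho>"
  unfolding character_def using assms
  by (simp_all add: peripheral_closed l_of_commutator representations_mult)

text \<open>X is covered by the closed sets y = 0, l = 2 and the two closures, so irreducibility
  puts it into one of them. The faithful character rules out the first two. As the closure is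
  irreducible, maximality of X gives equality.\<close>

lemma hyperbolic_curve_eq_closure:
  assumes "hyperbolic_curve piN X"
  obtains \<eta> where "\<eta>\<^sup>2 = - 1" "X = zariski_closure piN (character piN ` good_reps \<eta>)"
proof -
  let ?V = "character_variety piN" and ?C = "\<lambda>\<eta>. zariski_closure piN (character piN ` good_reps \<eta>)"
  obtain \<rho>0 where X: "irreducible_component piN X" and \<rho>0: "discrete_faithful piN \<rho>0" "character piN \<rho>0 \<in> X"
    using assms unfolding hyperbolic_curve_def by blast
  have irr: "irreducible_subset piN X" using X by (simp add: irreducible_component_def)
  then have XV: "X \<subseteq> ?V" by (simp add: irreducible_subset_def algebraic_subset_subset)
  define Y where "Y = {x \<in> ?V. \<forall>f\<in>{trace_fun ?V (piN_gen Beta)}. f x = 0}"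
  define L where "L = {x \<in> ?V. \<forall>f\<in>{\<lambda>x\<in>?V. trace_fun ?V peripheral x + (\<lambda>x\<in>?V. - 2) x}. f x = 0}"
  have alg: "algebraic_subset piN Y" "algebraic_subset piN L"
  proof -
    have "trace_fun ?V (piN_gen Beta) \<in> coordinate_ring piN ?V"
      by (rule trace_fun_in_coordinate_ring[OF piN_gen_closed])
    then show "algebraic_subset piN Y" unfolding Y_def by (intro algebraic_subsetI) blast
    have "(\<lambda>x\<in>?V. trace_fun ?V peripheral x + (\<lambda>x\<in>?V. - 2) x) \<in> coordinate_ring piN ?V"
      using trace_fun_in_coordinate_ring[OF peripheral_closed] unfolding coordinate_ring_def
      by (rule gen_add[OF _ gen_const])
    then show "algebraic_subset piN L" unfolding L_def by (intro algebraic_subsetI) blast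
  qed
  have algC: "algebraic_subset piN (?C \<eta>)" for \<eta> by (rule algebraic_zariski_closure)
  have good: "character piN ` good_reps \<eta> \<subseteq> ?C \<eta>" for \<eta>
    using zariski_closure_superset[of "character piN ` good_reps \<eta>" piN] character_good_reps by blast
  have "X \<subseteq> (Y \<union> L) \<union> (?C \<i> \<union> ?C (- \<i>))"
  proof
    fix v assume "v \<in> X"
    then have V: "v \<in> ?V" using XV by blast
    then obtain \<rho> where \<rho>: "\<rho> \<in> representations piN" "v = character piN \<rho>"
      unfolding character_variety_def by blast
    note ev = character_eval[OF \<rho>(1), folded \<rho>(2)]
    consider "y_of \<rho> = 0" | "l_of \<rho> = 2" | "\<rho> \<in> good_reps \<i> \<or> \<rho> \<in> good_reps (- \<i>)"
      using good_reps_cases[OF \<rho>(1)] by blast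
    then show "v \<in> (Y \<union> L) \<union> (?C \<i> \<union> ?C (- \<i>))"
    proof cases
      case 1
      then have "v \<in> Y" using V ev by (simp add: Y_def trace_fun_def)
      then show ?thesis by blast
    next
      case 2
      then have "v \<in> L" using V ev by (simp add: L_def trace_fun_def)
      then show ?thesis by blast
    next
      case 3
      then show ?thesis using good \<rho>(2) by blast
    qed
  qed
  then have "X \<subseteq> Y \<or> X \<subseteq> L \<or> X \<subseteq> ?C \<i> \<or> X \<subseteq> ?C (- \<i>)"
    using irreducible_subset_cases[OF irr] alg algC algebraic_subset_Un by metis
  moreover have "character piN \<rho>0 \<notin> Y" "character piN \<rho>0 \<notin> L"
  proof -
    have rep: "\<rho>0 \<in> representations piN" using \<rho>0 by (simp add: discrete_faithful_def)
    then show "character piN \<rho>0 \<notin> Y" "character piN \<rho>0 \<notin> L"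
      using discrete_faithful_good[OF \<rho>0(1)]
      by (simp_all add: Y_def L_def trace_fun_def character_eval)
  qed
  ultimately have "X \<subseteq> ?C \<i> \<or> X \<subseteq> ?C (- \<i>)" using \<rho>0(2) by blast
  then obtain \<eta> where \<eta>: "\<eta>\<^sup>2 = - 1" "X \<subseteq> ?C \<eta>"
    by (metis power2_i power2_minus)
  have "irreducible_subset piN (?C \<eta>)"
  proof (rule irreducible_zariski_closure)
    show "character piN ` good_reps \<eta> \<subseteq> ?V" using character_good_reps by blast
    show "character piN ` good_reps \<eta> \<noteq> {}" using good_reps_nonempty[OF \<eta>(1)] by blast
    fix f g assume fg: "f \<in> coordinate_ring piN ?V" "g \<in> coordinate_ring piN ?V"
      "\<forall>s\<in>character piN ` good_reps \<eta>. f s * g s = 0"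
    show "(\<forall>s\<in>character piN ` good_reps \<eta>. f s = 0) \<or> (\<forall>s\<in>character piN ` good_reps \<eta>. g s = 0)"
      using regular_product_zero[OF \<eta>(1) fg(1,2)[THEN coordinate_ring_regular]] fg(3) by simp
  qed
  then have "X = ?C \<eta>" using X \<eta>(2) unfolding irreducible_component_def by blast
  with \<eta>(1) show thesis using that by blast
qed

lemma mod_fun_in_coordinate_ring:
  fixes X :: "(generator word set \<Rightarrow> complex) set"
  shows "(\<lambda>x\<in>X. mod_fun c (x peripheral) (x (piN_gen Beta)) (x alpha_beta)) \<in> coordinate_ring piN X"
proof -
  let ?A = "generated_algebra X (trace_fun X ` carrier piN)"
  have gens: "(\<lambda>x\<in>X. x \<gamma>) \<in> ?A" if "\<gamma> \<in> carrier piN" for \<gamma>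
    using trace_fun_in_coordinate_ring[OF that, of X] by (simp add: coordinate_ring_def trace_fun_def)
  have P: "(\<lambda>x\<in>X. poly p (x peripheral)) \<in> ?A" for p
    using generated_algebra_poly[OF gens[OF peripheral_closed], of p] by (simp cong: restrict_cong)
  have pow: "(\<lambda>x\<in>X. x \<gamma> ^ n) \<in> ?A" if "\<gamma> \<in> carrier piN" for \<gamma> n
    using generated_algebra_poly[OF gens[OF that], of "monom 1 n"] by (simp add: poly_monom cong: restrict_cong)
  have mult: "(\<lambda>x\<in>X. f x * g x) \<in> ?A" if "restrict f X \<in> ?A" "restrict g X \<in> ?A" for f g
    using gen_mult[OF that] by (simp cong: restrict_cong)
  have add: "(\<lambda>x\<in>X. f x + g x) \<in> ?A" if "restrict f X \<in> ?A" "restrict g X \<in> ?A" for f g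
    using gen_add[OF that] by (simp cong: restrict_cong)
  have "(\<lambda>x\<in>X. \<Sum>n<m. poly (c n) (x peripheral) * (x alpha_beta ^ (n mod 4) * x (piN_gen Beta) ^ (n div 4))) \<in> ?A" for m
  proof (induction m)
    case 0
    show ?case unfolding lessThan_0 sum.empty by (rule gen_const)
  next
    case (Suc m)
    show ?case unfolding sum.lessThan_Suc by (intro add mult P pow Suc) auto
  qed
  then show ?thesis unfolding mod_fun_def coordinate_ring_def .
qed

section \<open>The basis of the coordinate ring\<close>

theorem lemma7p13:
  fixes X :: "(generator word set \<Rightarrow> complex) set"
    and l y z :: "(generator word set \<Rightarrow> complex) \<Rightarrow> complex"
    and B :: "((generator word set \<Rightarrow> complex) \<Rightarrow> complex) set"
  assumes "hyperbolic_curve piN X"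
    and "l = trace_fun X (commutator piN (piN_gen Alpha) (piN_gen Beta))"
    and "y = trace_fun X (piN_gen Beta)"
    and "z = trace_fun X (piN_gen Alpha \<otimes>\<^bsub>piN\<^esub> piN_gen Beta)"
    and "B = {(\<lambda>x\<in>X. 1), (\<lambda>x\<in>X. z x), (\<lambda>x\<in>X. z x ^ 2), (\<lambda>x\<in>X. z x ^ 3),
              (\<lambda>x\<in>X. y x), (\<lambda>x\<in>X. z x * y x), (\<lambda>x\<in>X. z x ^ 2 * y x), (\<lambda>x\<in>X. z x ^ 3 * y x)}"
  shows "card B = 8 \<and> module_basis X (generated_algebra X {l}) (coordinate_ring piN X) B"
proof -
  let ?V = "character_variety piN"
  obtain \<eta> where \<eta>: "\<eta>\<^sup>2 = - 1" and X: "X = zariski_closure piN (character piN ` good_reps \<eta>)"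
    using hyperbolic_curve_eq_closure[OF assms(1)] .
  have XV: "X \<subseteq> ?V" unfolding X zariski_closure_def by blast
  have in_X: "character piN \<rho> \<in> X" if "\<rho> \<in> good_reps \<eta>" for \<rho>
    using zariski_closure_superset[of "character piN ` good_reps \<eta>" piN] character_good_reps that
    unfolding X by blast
  have lyz: "l x = x peripheral" "y x = x (piN_gen Beta)" "z x = x alpha_beta" if "x \<in> X" for x
    using that by (simp_all add: assms(2-4) trace_fun_def)
  \<comment> \<open>Numbering the monomials as in \<open>mod_fun\<close> turns sums over
    \<open>B\<close> into sums over the indices below 8.\<close>
  define b where "b = (\<lambda>n::nat. \<lambda>x\<in>X. z x ^ (n mod 4) * y x ^ (n div 4))"
  have B: "B = b ` {..<8}"
  proof -
    have "{..<8::nat} = {0, 1, 2, 3, 4, 5, 6, 7}" by auto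
    then show ?thesis unfolding assms(5) b_def by simp
  qed
  have sum_b: "(\<Sum>n<8. poly (c n) (l x) * b n x) = mod_fun c (x peripheral) (x (piN_gen Beta)) (x alpha_beta)"
    if "x \<in> X" for c x
    using that by (simp add: mod_fun_def b_def lyz)
  have indep: "c n = 0" if 0: "\<forall>x\<in>X. (\<Sum>n<8. poly (c n) (l x) * b n x) = 0" and "n < 8" for c n
  proof (rule mod_fun_independent[OF \<eta> _ \<open>n < 8\<close>])
    fix \<rho> assume \<rho>: "\<rho> \<in> good_reps \<eta>"
    then have "\<rho> \<in> representations piN" by (simp add: good_reps_def)
    then show "mod_fun c (l_of \<rho>) (y_of \<rho>) (z_of \<rho>) = 0"
      using 0 in_X[OF \<rho>] sum_b[OF in_X[OF \<rho>], of c] by (simp add: character_eval)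
  qed
  have inj: "inj_on b {..<8}"
  proof (rule inj_onI, rule ccontr)
    fix n m :: nat assume nm: "n \<in> {..<8}" "m \<in> {..<8}" "b n = b m" "n \<noteq> m"
    \<comment> \<open>Two equal monomials with different indices would satisfy the relation with
      coefficients 1 and -1.\<close>
    let ?c = "\<lambda>k. if k = n then 1 else if k = m then - 1 else 0 :: complex poly"
    have "(\<Sum>k<8. poly (?c k) (l x) * b k x) = 0" for x
    proof -
      have "(\<Sum>k<8. poly (?c k) (l x) * b k x) = (\<Sum>k\<in>{n, m}. poly (?c k) (l x) * b k x)"
        using nm by (intro sum.mono_neutral_right) auto
      then show ?thesis using nm by simp
    qed
    then have "?c n = 0" using indep[of ?c n] nm(1) by blast
    then show False by simp
  qed
  have sum_B: "(\<Sum>f\<in>B. g f) = (\<Sum>n<8. g (b n))" for g :: "_ \<Rightarrow> complex"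
    unfolding B by (simp add: sum.reindex[OF inj])
  have "card B = 8" unfolding B by (simp add: card_image[OF inj])
  moreover have "finite B" unfolding B by simp
  moreover have "B \<subseteq> coordinate_ring piN X"
  proof
    fix f assume "f \<in> B"
    then obtain n where n: "n < 8" "f = b n" unfolding B by blast
    let ?c = "\<lambda>k. if k = n then 1 else 0 :: complex poly"
    have "b n = (\<lambda>x\<in>X. mod_fun ?c (x peripheral) (x (piN_gen Beta)) (x alpha_beta))"
    proof
      fix x
      have "(\<Sum>k<8. poly (?c k) (l x) * b k x) = b n x"
        using n by (simp add: if_distrib if_distribR sum.delta cong: if_cong)
      then show "b n x = (\<lambda>x\<in>X. mod_fun ?c (x peripheral) (x (piN_gen Beta)) (x alpha_beta)) x"
        using sum_b[of x ?c] by (auto simp: b_def)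
    qed
    then show "f \<in> coordinate_ring piN X"
      using mod_fun_in_coordinate_ring[of ?c X] n by simp
  qed
  moreover have "\<forall>f\<in>coordinate_ring piN X. \<exists>c \<in> B \<rightarrow> generated_algebra X {l}.
      f = (\<lambda>x\<in>X. \<Sum>b\<in>B. c b x * b x)"
  proof
    fix f assume "f \<in> coordinate_ring piN X"
    then obtain g where g: "g \<in> coordinate_ring piN ?V" "f = restrict g X"
      using coordinate_ring_restrict[OF XV] by blast
    have "\<exists>c. \<forall>\<rho>\<in>good_reps \<eta>. g (character piN \<rho>) = mod_fun c (l_of \<rho>) (y_of \<rho>) (z_of \<rho>)"
      by (rule regular_spanned[OF coordinate_ring_regular[OF g(1)]])
    then obtain c where c: "\<forall>\<rho>\<in>good_reps \<eta>. g (character piN \<rho>) = mod_fun c (l_of \<rho>) (y_of \<rho>) (z_of \<rho>)"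
      by (rule exE)
    let ?m = "\<lambda>x\<in>?V. mod_fun c (x peripheral) (x (piN_gen Beta)) (x alpha_beta)"
    \<comment> \<open>The difference of g and its normal form, written in the shape of the closure
      rules. It vanishes on the good characters and therefore on their closure X, which may contain
      further points.\<close>
    define h where "h = (\<lambda>x\<in>?V. g x + (\<lambda>x\<in>?V. (\<lambda>x\<in>?V. - 1) x * ?m x) x)"
    have "h \<in> coordinate_ring piN ?V"
      using g(1) mod_fun_in_coordinate_ring[of c ?V] unfolding h_def coordinate_ring_def
      by (intro gen_add gen_mult gen_const)
    moreover have "h s = 0" if s: "s \<in> character piN ` good_reps \<eta>" for s
    proof -
      obtain \<rho> where \<rho>: "\<rho> \<in> good_reps \<eta>" "s = character piN \<rho>" using s by blast
      then have "\<rho> \<in> representations piN" "s \<in> ?V"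
        by (simp_all add: good_reps_def character_good_reps character_variety_def)
      then show ?thesis using c \<rho> by (simp add: h_def character_eval)
    qed
    ultimately have h0: "h x = 0" if "x \<in> X" for x
      using that unfolding X zariski_closure_def by blast
    have "f x = (\<Sum>n<8. poly (c n) (l x) * b n x)" if "x \<in> X" for x
    proof -
      have "x \<in> ?V" using that XV by blast
      then show ?thesis using h0[OF that] that unfolding sum_b[OF that] by (simp add: g(2) h_def)
    qed
    \<comment> \<open>A basis coefficient is attached to a function in \<open>B\<close>, so the
      index is recovered by inverting b.\<close>
    moreover define C where "C = (\<lambda>a. \<lambda>x\<in>X. poly (c (the_inv_into {..<8} b a)) (l x))"
    have "C (b n) x = poly (c n) (l x)" if "n < 8" "x \<in> X" for n x
      using that the_inv_into_f_f[OF inj, of n] by (simp add: C_def)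
    then have "(\<Sum>a\<in>B. C a x * a x) = (\<Sum>n<8. poly (c n) (l x) * b n x)" if "x \<in> X" for x
      unfolding sum_B using that by simp
    ultimately have "f = (\<lambda>x\<in>X. \<Sum>a\<in>B. C a x * a x)"
      using g(2) by (intro ext) (auto simp: restrict_def)
    moreover have "C \<in> B \<rightarrow> generated_algebra X {l}"
    proof
      fix a
      have "restrict l X \<in> generated_algebra X {l}" by (rule gen_base) simp
      from generated_algebra_poly[OF this, of "c (the_inv_into {..<8} b a)"]
      show "C a \<in> generated_algebra X {l}" by (simp add: C_def cong: restrict_cong)
    qed
    ultimately show "\<exists>c \<in> B \<rightarrow> generated_algebra X {l}. f = (\<lambda>x\<in>X. \<Sum>b\<in>B. c b x * b x)" by blast
  qed
  moreover have "\<forall>b\<in>B. \<forall>x\<in>X. C b x = 0"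
    if C: "C \<in> B \<rightarrow> generated_algebra X {l}" "\<forall>x\<in>X. (\<Sum>b\<in>B. C b x * b x) = 0" for C
  proof (intro ballI)
    fix f x assume "f \<in> B" "x \<in> X"
    \<comment> \<open>Coefficients in the algebra generated by l are polynomials in l, which brings
      the relation into the form treated by \<open>indep\<close>.\<close>
    have "\<exists>p. C (b n) = (\<lambda>x\<in>X. poly p (l x))" if "n < 8" for n
    proof -
      have "C (b n) \<in> generated_algebra X {l}" using C(1) that unfolding B by auto
      then show ?thesis using generated_algebra_singleton by blast
    qed
    then obtain c where c: "\<And>n. n < 8 \<Longrightarrow> C (b n) = (\<lambda>x\<in>X. poly (c n) (l x))" by metis
    have "\<forall>x\<in>X. (\<Sum>n<8. poly (c n) (l x) * b n x) = 0"
      using C(2) unfolding sum_B by (simp add: c)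
    then have "c n = 0" if "n < 8" for n using indep that by blast
    moreover obtain n where "n < 8" "f = b n" using \<open>f \<in> B\<close> unfolding B by blast
    ultimately show "C f x = 0" using c \<open>x \<in> X\<close> by simp
  qed
  ultimately show ?thesis unfolding module_basis_def by blast
qed

end
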